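(* Let $k$ be a positive integer and $g\in G_k$, with $$g=b+\rho^{k-2}m+O(\rho^{k-1}),$$ where $m$ is a section of $\mathrm{Sym}^2(T^*\mathbb R^n|_{\mathbb S^{n-1}})$. Let $\Theta$ be the adjustment diffeomorphism of $g$. Then the metric $\tilde g=\Theta_*g$ has the asymptotic expansion $$\tilde g=b+\rho^{k-2}\tilde m+O(\rho^{k-1}),$$ where the section $\tilde m$ of $\mathrm{Sym}^2(T^*\mathbb S^{n-1})$ is given by $$\tilde m_{ij}=m_{ij}-m_{aj}x^ax_i-m_{ia}x^ax_j+m_{ab}\frac{x^ax^b}{k}\big((k-1)x_ix_j+\delta_{ij}\big).$$
   Context: $\delta$ is the Euclidean metric on $\mathbb R^n$ with Cartesian coordinates $x^1,\dots,x^n$ ($x_i=x^i$), $\rho(x)=\frac{1-|x|^2}{2}$, $b=\rho^{-2}\delta$ is the hyperbolic metric on $B_1(0)$, $\mathbb S^{n-1}=\partial B_1(0)$. Repeated indices are summed from $1$ to $n$. A neighborhood of infinity is an open $U\subset B_1(0)$ containing $B_1(0)\setminus\overline B_{1-\epsilon}(0)$ for some $\epsilon>0$; $\tilde U=U\cup\mathbb S^{n-1}$. $G_k$ is the set of germs at infinity (pairs $(U,g)$, identified if they agree on a smaller neighborhood of infinity) of Riemannian metrics $g$ on $U$ such that $\rho^2g$ extends to a smooth metric on $\tilde U$ with $|g-b|_b=O(\rho^k)$. A germ $g$ is transverse if $g(P,\cdot)=b(P,\cdot)$ near infinity, $P=x^i\partial_i$. $I_0^{k+1}$ is the group of germs at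 infinity of diffeomorphisms $\Theta:\tilde U\to\Theta(\tilde U)$ (smooth up to $\mathbb S^{n-1}$) with $|\Theta(x)-x|_\delta=O(\rho^{k+1})$. For each $g\in G_k$ there is a unique $\Theta\in I_0^{k+1}$ with $\Theta_*g$ transverse, called the adjustment diffeomorphism of $g$. The expansion $g=b+\rho^{k-2}m+O(\rho^{k-1})$ means that $m$ is the restriction to $\mathbb S^{n-1}$ of the smooth tensor $\rho^{-k}(\rho^2g-\delta)$ (components taken in Cartesian coordinates). A symmetric 2-tensor on $T\mathbb R^n|_{\mathbb S^{n-1}}$ annihilating the position vector $x^i\partial_i$ is identified with a section of $\mathrm{Sym}^2(T^*\mathbb S^{n-1})$. *)

theory Defs
  imports "HOL-Analysis.Analysis" "HOL-Library.Landau_Symbols"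
begin

section \<open>Smooth maps\<close>

(* C^k on an open set S: all iterated directional derivatives up to order k exist
   (as Frechet derivatives) and are continuous. Only meaningful for open S. *)
primrec Ck_on ::
  "nat \<Rightarrow> 'a::euclidean_space set \<Rightarrow> ('a \<Rightarrow> 'b::real_normed_vector) \<Rightarrow> bool" where
  "Ck_on 0 S f \<longleftrightarrow> continuous_on S f"
| "Ck_on (Suc k) S f \<longleftrightarrow>
     (\<forall>x\<in>S. f differentiable (at x)) \<and> (\<forall>v. Ck_on k S (\<lambda>x. frechet_derivative f (at x) v))"

(* Smoothness on an arbitrary subset A: locally the restriction of a C^infinity map on an
   open set. For A = U \<union> sphere 0 1 this is smoothness up to the boundary. *)
definition smooth_on :: "'a::euclidean_space set \<Rightarrow> ('a \<Rightarrow> 'b::real_normed_vector) \<Rightarrow> bool" where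
  "smooth_on A f \<longleftrightarrow>
     (\<forall>p\<in>A. \<exists>W F. open W \<and> p \<in> W \<and> (\<forall>k. Ck_on k W F) \<and> (\<forall>x\<in>A \<inter> W. F x = f x))"

section \<open>Metrics on the ball\<close>

(* A covariant 2-tensor field is the matrix-valued function of its Cartesian components. *)
type_synonym 'n tensor = "real^'n \<Rightarrow> real^'n^'n"

definition is_metric_on :: "(real^'n) set \<Rightarrow> 'n::finite tensor \<Rightarrow> bool" where
  "is_metric_on A g \<longleftrightarrow>
     smooth_on A g \<and>
     (\<forall>x\<in>A. transpose (g x) = g x \<and> (\<forall>v. v \<noteq> 0 \<longrightarrow> v \<bullet> (g x *v v) > 0))"

(* Norm of the covariant 2-tensor T induced by the inner product with matrix G:
   |T|^2 = G^{ia} G^{jc} T_ij T_ac. *)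
definition tensor_norm :: "real^'n^'n \<Rightarrow> real^'n^'n \<Rightarrow> real" where
  "tensor_norm G T =
     sqrt (\<Sum>i\<in>UNIV. \<Sum>j\<in>UNIV. \<Sum>a\<in>UNIV. \<Sum>c\<in>UNIV.
             matrix_inv G $ i $ a * matrix_inv G $ j $ c * T $ i $ j * T $ a $ c)"

definition rho :: "real^'n \<Rightarrow> real" where
  "rho x = (1 - (norm x)\<^sup>2) / 2"

definition hyp_metric :: "'n::finite tensor" where
  "hyp_metric x = (1 / (rho x)\<^sup>2) *\<^sub>R mat 1"

section \<open>Germs at infinity\<close>

definition nbhd_infinity :: "(real^'n) set \<Rightarrow> bool" where
  "nbhd_infinity U \<longleftrightarrow>
     open U \<and> U \<subseteq> ball 0 1 \<and> (\<exists>\<epsilon>>0. ball 0 1 - cball 0 (1 - \<epsilon>) \<subseteq> U)"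

definition with_boundary :: "(real^'n) set \<Rightarrow> (real^'n) set" where
  "with_boundary U = U \<union> sphere 0 1"

(* The filter of neighborhoods of infinity: norm x tends to 1 from below. *)
definition near_infinity :: "(real^'n) filter" where
  "near_infinity = filtercomap norm (at_left 1)"

(* A germ at infinity is handled through its representatives, pairs of a domain and a map.
   Every predicate below is preserved when a representative is restricted to a smaller
   neighborhood of infinity. Values of the map off its domain (off the domain and the
   boundary sphere, for diffeomorphisms) are irrelevant. *)
type_synonym 'n tensor_germ = "(real^'n) set \<times> 'n tensor"
type_synonym 'n map_germ = "(real^'n) set \<times> (real^'n \<Rightarrow> real^'n)"

definition G :: "nat \<Rightarrow> 'n::finite tensor_germ set" where
  "G k = {(U, g). nbhd_infinity U \<and> is_metric_on U g \<and>
     (\<exists>h. is_metric_on (with_boundary U) h \<and> (\<forall>x\<in>U. h x = (rho x)\<^sup>2 *\<^sub>R g x)) \<and>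
     (\<lambda>x. tensor_norm (hyp_metric x) (g x - hyp_metric x)) \<in> O[near_infinity](\<lambda>x. rho x ^ k)}"

(* The position vector field P at x is x itself. *)
definition transverse :: "'n::finite tensor_germ \<Rightarrow> bool" where
  "transverse = (\<lambda>(U, g). nbhd_infinity U \<and>
     (\<forall>\<^sub>F x in near_infinity. \<forall>w. x \<bullet> (g x *v w) = x \<bullet> (hyp_metric x *v w)))"

(* The exponent is the order of agreement with the identity: the group written
   I_0^{k+1} is I0 (k + 1). *)
definition I0 :: "nat \<Rightarrow> 'n::finite map_germ set" where
  "I0 l = {(U, \<Theta>). nbhd_infinity U \<and> nbhd_infinity (\<Theta> ` U) \<and>
     \<Theta> ` sphere 0 1 = sphere 0 1 \<and>
     inj_on \<Theta> (with_boundary U) \<and>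
     smooth_on (with_boundary U) \<Theta> \<and>
     smooth_on (\<Theta> ` with_boundary U) (inv_into (with_boundary U) \<Theta>) \<and>
     (\<lambda>x. norm (\<Theta> x - x)) \<in> O[near_infinity](\<lambda>x. rho x ^ l)}"

(* (Theta_* g)_y (v, w) = g_{Psi y} (D Psi_y v, D Psi_y w) with Psi the inverse of Theta. *)
definition pushforward :: "'n::finite map_germ \<Rightarrow> 'n tensor_germ \<Rightarrow> 'n tensor_germ" where
  "pushforward = (\<lambda>(V, \<Theta>) (U, g).
     (\<Theta> ` (U \<inter> V),
      \<lambda>y. let \<Psi> = inv_into (with_boundary V) \<Theta>;
              J = matrix (frechet_derivative \<Psi> (at y))
          in transpose J ** g (\<Psi> y) ** J))"

definition adjustment_diffeo ::
  "nat \<Rightarrow> 'n::finite tensor_germ \<Rightarrow> 'n map_germ \<Rightarrow> bool" where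
  "adjustment_diffeo k g \<Theta> \<longleftrightarrow> \<Theta> \<in> I0 (k + 1) \<and> transverse (pushforward \<Theta> g)"

section \<open>Asymptotic expansions\<close>

definition Sym2_section :: "'n::finite tensor \<Rightarrow> bool" where
  "Sym2_section m \<longleftrightarrow>
     smooth_on (sphere 0 1) m \<and> (\<forall>x\<in>sphere 0 1. transpose (m x) = m x)"

(* Sections of Sym^2(T^* S^{n-1}), identified with the symmetric 2-tensors on the
   ambient space that annihilate the position vector. *)
definition Sym2_sphere_section :: "'n::finite tensor \<Rightarrow> bool" where
  "Sym2_sphere_section m \<longleftrightarrow> Sym2_section m \<and> (\<forall>x\<in>sphere 0 1. m x *v x = 0)"

(* g = b + rho^{k-2} m + O(rho^{k-1}): the tensor rho^{-k} (rho^2 g - delta) extends smoothly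
   to the boundary sphere, with restriction m there. *)
definition has_expansion :: "nat \<Rightarrow> 'n::finite tensor_germ \<Rightarrow> 'n tensor \<Rightarrow> bool" where
  "has_expansion k = (\<lambda>(U, g) m. nbhd_infinity U \<and>
     (\<exists>T. smooth_on (with_boundary U) T \<and>
          (\<forall>x\<in>U. T x = (1 / rho x ^ k) *\<^sub>R ((rho x)\<^sup>2 *\<^sub>R g x - mat 1)) \<and>
          (\<forall>x\<in>sphere 0 1. T x = m x)))"

end

theory Submission
  imports Defs
begin

text \<open>
  Near a boundary point the inverse \<open>\<Psi>\<close> of the adjustment diffeomorphism has the form
  \<open>\<Psi> y = y + rho^(k+1) \<phi> y\<close> with \<open>\<phi>\<close> smooth up to the sphere, by iterated Hadamard division by
  \<open>rho\<close>. Hence \<open>rho (\<Psi> y) = rho (1 - rho^k (y \<bullet> \<phi>) + ...)\<close> and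
  \<open>D\<Psi> = 1 - (k+1) rho^k \<phi> y^T + ...\<close>, so the rescaled pushforward is
  \<open>1 + rho^k (2 (y \<bullet> \<phi>) 1 - (k+1) (\<phi> y^T + y \<phi>^T) + m) + ...\<close>. Transversality says that the
  coefficient of \<open>rho^k\<close> annihilates \<open>y\<close> on the sphere. This determines \<open>\<phi>\<close> there and gives the
  formula.
\<close>

section \<open>Calculus of smooth maps\<close>

text \<open>The conclusion asks for a smooth extension of the quotient
  \<open>rho^(-k) (rho^2 g - 1)\<close> itself, so O-estimates cannot deliver it: every remainder
  has to be a power of \<open>rho\<close> times a function smooth across the sphere. The hypothesis
  on the diffeomorphism, however, is a mere size estimate, and it measures the displacement by
  \<open>rho\<close> at \<open>x\<close>, whereas a pushforward is a pullback by the inverse and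
  lives at \<open>y\<close>, the image of \<open>x\<close>. Hence the estimate is first moved to the
  image, and Hadamard division then turns size into a smooth factor. From there on all identities
  are exact, because \<open>rho\<close> is quadratic and the pullback is algebraic in the Jacobian.
  Extensions on balls around boundary points are arbitrary outside the closed unit ball, but on the
  domain and the sphere they all give the same tensor, so no gluing is required.\<close>

lemma Ck_on_imp_continuous_on:
  "Ck_on k S f \<Longrightarrow> continuous_on S f"
  by (cases k) (simp_all add: continuous_at_imp_continuous_on differentiable_imp_continuous_within)

lemma Ck_on_subset: "Ck_on k S f \<Longrightarrow> T \<subseteq> S \<Longrightarrow> Ck_on k T f"
  by (induction k arbitrary: f) (auto intro: continuous_on_subset)

text \<open>A derivative at a point of an open set sees only values on that set, so agreement passes
  from the maps to their directional derivatives.\<close>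

lemma Ck_on_cong:
  assumes "open S" "\<And>x. x \<in> S \<Longrightarrow> f x = g x" "Ck_on k S f"
  shows "Ck_on k S g"
  using assms(2,3)
proof (induction k arbitrary: f g)
  case 0
  then show ?case using continuous_on_cong[of S S f g] by auto
next
  case (Suc k)
  have D: "(g has_derivative frechet_derivative f (at x)) (at x)" if "x \<in> S" for x
  proof -
    have "(f has_derivative frechet_derivative f (at x)) (at x)"
      using Suc.prems(2) that by (simp add: frechet_derivative_works)
    then show ?thesis
      by (rule has_derivative_transform_within_open[OF _ \<open>open S\<close> that]) (use Suc.prems in auto)
  qed
  show ?case
  proof (simp, intro conjI ballI allI)
    fix x assume "x \<in> S" then show "g differentiable at x" using D differentiableI by blast
  next
    fix v
    have "frechet_derivative f (at x) v = frechet_derivative g (at x) v" if "x \<in> S" for x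
      using frechet_derivative_at[OF D[OF that]] by simp
    moreover have "Ck_on k S (\<lambda>x. frechet_derivative f (at x) v)"
      using Suc.prems(2) by simp
    ultimately show "Ck_on k S (\<lambda>x. frechet_derivative g (at x) v)"
      by (rule Suc.IH)
  qed
qed

text \<open>Allows the derivative to be given by an explicit formula; uniqueness of the derivative
  identifies it with \<open>frechet_derivative\<close>.\<close>

lemma Ck_on_SucI:
  assumes "open S" "\<And>x. x \<in> S \<Longrightarrow> (f has_derivative f' x) (at x)"
    and "\<And>v. Ck_on k S (\<lambda>x. f' x v)"
  shows "Ck_on (Suc k) S f"
proof (simp, intro conjI ballI allI)
  fix x assume "x \<in> S" then show "f differentiable at x" using assms(2) differentiableI by blast
next
  fix v
  show "Ck_on k S (\<lambda>x. frechet_derivative f (at x) v)"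
    by (rule Ck_on_cong[OF assms(1) _ assms(3)[of v]]) (metis assms(2) frechet_derivative_at)
qed

lemma Ck_on_Suc_has_derivative:
  "Ck_on (Suc k) S f \<Longrightarrow> x \<in> S \<Longrightarrow> (f has_derivative frechet_derivative f (at x)) (at x)"
  using frechet_derivative_works by auto

lemma Ck_on_SucD: "Ck_on (Suc k) S f \<Longrightarrow> Ck_on k S f"
  by (induction k arbitrary: f)
    (simp_all add: continuous_at_imp_continuous_on differentiable_imp_continuous_within)

lemma Ck_on_const: "open S \<Longrightarrow> Ck_on k S (\<lambda>x. c)"
proof (induction k arbitrary: c)
  case (Suc k)
  show ?case by (rule Ck_on_SucI[where f' = "\<lambda>x v. 0"]) (use Suc in auto)
qed simp

lemma Ck_on_bounded_linear:
  assumes "open S" "bounded_linear L" "Ck_on k S f"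
  shows "Ck_on k S (\<lambda>x. L (f x))"
  using assms(3)
proof (induction k arbitrary: f)
  case 0
  then show ?case by (simp add: assms bounded_linear.continuous_on)
next
  case (Suc k)
  show ?case
  proof (rule Ck_on_SucI[OF assms(1)])
    show "((\<lambda>x. L (f x)) has_derivative (\<lambda>v. L (frechet_derivative f (at x) v))) (at x)" if "x \<in> S" for x
      by (rule bounded_linear.has_derivative[OF assms(2) Ck_on_Suc_has_derivative[OF Suc.prems that]])
    show "Ck_on k S (\<lambda>x. L (frechet_derivative f (at x) v))" for v
      by (rule Suc.IH) (use Suc.prems in simp)
  qed
qed

lemma Ck_on_id: "open S \<Longrightarrow> Ck_on k S (\<lambda>x. x)"
proof (cases k)
  case (Suc j)
  assume "open S"
  then show ?thesis unfolding Suc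
    by (intro Ck_on_SucI[where f' = "\<lambda>x v. v"] Ck_on_const) auto
qed (simp add: continuous_on_id)

lemma Ck_on_add:
  assumes "open S" "Ck_on k S f" "Ck_on k S g"
  shows "Ck_on k S (\<lambda>x. f x + g x)"
  using assms(2,3)
proof (induction k arbitrary: f g)
  case 0
  then show ?case by (simp add: continuous_on_add)
next
  case (Suc k)
  show ?case
  proof (rule Ck_on_SucI[OF assms(1)])
    show "((\<lambda>x. f x + g x) has_derivative
        (\<lambda>v. frechet_derivative f (at x) v + frechet_derivative g (at x) v)) (at x)" if "x \<in> S" for x
      by (rule has_derivative_add[OF Ck_on_Suc_has_derivative[OF Suc.prems(1) that]
            Ck_on_Suc_has_derivative[OF Suc.prems(2) that]])
    show "Ck_on k S (\<lambda>x. frechet_derivative f (at x) v + frechet_derivative g (at x) v)" for v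
      by (rule Suc.IH) (use Suc.prems in simp_all)
  qed
qed

lemma Ck_on_sum:
  assumes "open S" "\<And>i. i \<in> I \<Longrightarrow> Ck_on k S (f i)"
  shows "Ck_on k S (\<lambda>x. \<Sum>i\<in>I. f i x)"
  using assms(2)
  by (induction I rule: infinite_finite_induct) (simp_all add: Ck_on_const Ck_on_add assms(1))

lemma Ck_on_bilinear:
  assumes "open S" "bounded_bilinear h" "Ck_on k S f" "Ck_on k S g"
  shows "Ck_on k S (\<lambda>x. h (f x) (g x))"
  using assms(3,4)
proof (induction k arbitrary: f g)
  case 0
  then show ?case by (simp add: bounded_bilinear.continuous_on[OF assms(2)])
next
  case (Suc k)
  show ?case
  proof (rule Ck_on_SucI[OF assms(1)])
    fix x assume "x \<in> S"
    then show "((\<lambda>x. h (f x) (g x)) has_derivative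
        (\<lambda>v. h (f x) (frechet_derivative g (at x) v) + h (frechet_derivative f (at x) v) (g x))) (at x)"
      by (intro bounded_bilinear.FDERIV[OF assms(2)] Ck_on_Suc_has_derivative) (use Suc.prems in auto)
  next
    fix v
    show "Ck_on k S (\<lambda>x. h (f x) (frechet_derivative g (at x) v) + h (frechet_derivative f (at x) v) (g x))"
      by (intro Ck_on_add[OF assms(1)] Suc.IH Suc.prems[THEN Ck_on_SucD]) (use Suc.prems in auto)
  qed
qed

text \<open>The chain rule feeds the derivative of \<open>g\<close> a direction that moves with
  \<open>x\<close>, whereas \<open>Ck_on\<close> speaks of fixed directions. Expanding that
  direction in the basis gives a finite sum of products, and the induction hypothesis applies to the
  derivative of \<open>g\<close> along each basis vector.\<close>

lemma Ck_on_compose: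
  fixes f :: "'a::euclidean_space \<Rightarrow> 'b::euclidean_space" and g :: "'b \<Rightarrow> 'c::real_normed_vector"
  assumes "open S" "f ` S \<subseteq> T" "Ck_on k S f" "Ck_on k T g"
  shows "Ck_on k S (\<lambda>x. g (f x))"
  using assms(3,4)
proof (induction k arbitrary: g)
  case 0
  then show ?case using continuous_on_compose2[OF _ _ assms(2), of g] by simp
next
  case (Suc k)
  have fS: "Ck_on k S f" using Suc.prems Ck_on_SucD by blast
  show ?case
  proof (rule Ck_on_SucI[OF assms(1)])
    fix x assume x: "x \<in> S"
    have Dg: "(g has_derivative frechet_derivative g (at (f x))) (at (f x))"
      by (rule Ck_on_Suc_has_derivative[OF Suc.prems(2)]) (use assms(2) x in auto)
    then interpret bounded_linear "frechet_derivative g (at (f x))"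
      by (rule has_derivative_bounded_linear)
    have "(\<Sum>b\<in>Basis. (w \<bullet> b) *\<^sub>R frechet_derivative g (at (f x)) b) = frechet_derivative g (at (f x)) w" for w
    proof -
      have "(\<Sum>b\<in>Basis. (w \<bullet> b) *\<^sub>R frechet_derivative g (at (f x)) b)
        = frechet_derivative g (at (f x)) (\<Sum>b\<in>Basis. (w \<bullet> b) *\<^sub>R b)"
        by (simp only: sum scaleR)
      then show ?thesis by (simp only: euclidean_representation)
    qed
    then have eq: "(\<lambda>v. \<Sum>b\<in>Basis. (frechet_derivative f (at x) v \<bullet> b) *\<^sub>R frechet_derivative g (at (f x)) b)
      = (\<lambda>v. frechet_derivative g (at (f x)) (frechet_derivative f (at x) v))"
      by (rule ext)
    show "((\<lambda>x. g (f x)) has_derivative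
        (\<lambda>v. \<Sum>b\<in>Basis. (frechet_derivative f (at x) v \<bullet> b) *\<^sub>R frechet_derivative g (at (f x)) b)) (at x)"
      unfolding eq
      by (rule has_derivative_compose[OF Ck_on_Suc_has_derivative[OF Suc.prems(1) x] Dg])
  next
    fix v
    show "Ck_on k S (\<lambda>x. \<Sum>b\<in>Basis. (frechet_derivative f (at x) v \<bullet> b) *\<^sub>R frechet_derivative g (at (f x)) b)"
      by (intro Ck_on_sum Ck_on_bilinear[OF _ bounded_bilinear_scaleR] assms(1) Suc.IH fS
          Ck_on_bounded_linear[OF _ bounded_linear_inner_left])
        (use Suc.prems in auto)
  qed
qed

text \<open>A general exponent keeps the family closed under differentiation. It later yields
  reciprocals (exponent \<open>-1\<close>) and norms (exponent \<open>1/2\<close>).\<close>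

lemma Ck_on_powr: "Ck_on k {0<..} (\<lambda>x::real. x powr a)"
proof (induction k arbitrary: a)
  case 0
  show ?case by (auto intro!: continuous_intros)
next
  case (Suc k)
  show ?case
  proof (rule Ck_on_SucI)
    fix x :: real assume x: "x \<in> {0<..}"
    have "((\<lambda>x. x powr a) has_real_derivative a * x powr (a - 1)) (at x)"
      by (rule has_real_derivative_powr) (use x in auto)
    moreover have "(*) (a * x powr (a - 1)) = (\<lambda>v. (a * v) *\<^sub>R (x powr (a - 1)))"
      by (simp add: fun_eq_iff)
    ultimately show "((\<lambda>x. x powr a) has_derivative (\<lambda>v. (a * v) *\<^sub>R (x powr (a - 1)))) (at x)"
      by (simp only: has_field_derivative_def)
  next
    fix v
    show "Ck_on k {0<..} (\<lambda>x. (a * v) *\<^sub>R (x powr (a - 1)))"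
      by (intro Ck_on_bounded_linear[OF _ bounded_linear_scaleR_right] Suc.IH) auto
  qed simp
qed

text \<open>Openness is built in because \<open>Ck_on\<close> is meaningful only on open sets; the
  pair is the kind of local witness that \<open>smooth_on\<close> asks for.\<close>

definition Cinf_on :: "'a::euclidean_space set \<Rightarrow> ('a \<Rightarrow> 'b::real_normed_vector) \<Rightarrow> bool" where
  "Cinf_on S f \<longleftrightarrow> open S \<and> (\<forall>k. Ck_on k S f)"

lemma Cinf_on_open: "Cinf_on S f \<Longrightarrow> open S"
  by (simp add: Cinf_on_def)

lemma Cinf_on_subset: "Cinf_on S f \<Longrightarrow> open T \<Longrightarrow> T \<subseteq> S \<Longrightarrow> Cinf_on T f"
  by (auto simp: Cinf_on_def intro: Ck_on_subset)

lemma Cinf_on_cong: "Cinf_on S f \<Longrightarrow> (\<And>x. x \<in> S \<Longrightarrow> f x = g x) \<Longrightarrow> Cinf_on S g"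
  by (auto simp: Cinf_on_def intro: Ck_on_cong)

lemma Cinf_on_continuous: "Cinf_on S f \<Longrightarrow> continuous_on S f"
  by (auto simp: Cinf_on_def intro: Ck_on_imp_continuous_on)

lemma Cinf_on_isCont: "Cinf_on S f \<Longrightarrow> x \<in> S \<Longrightarrow> isCont f x"
  using Cinf_on_continuous Cinf_on_open continuous_on_eq_continuous_at by blast

lemma Cinf_on_has_derivative:
  "Cinf_on S f \<Longrightarrow> x \<in> S \<Longrightarrow> (f has_derivative frechet_derivative f (at x)) (at x)"
  unfolding Cinf_on_def using Ck_on_Suc_has_derivative by blast

lemma Cinf_on_frechet_derivative: "Cinf_on S f \<Longrightarrow> Cinf_on S (\<lambda>x. frechet_derivative f (at x) v)"
  unfolding Cinf_on_def by (metis Ck_on.simps(2))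

lemma Cinf_on_const: "open S \<Longrightarrow> Cinf_on S (\<lambda>x. c)"
  by (simp add: Cinf_on_def Ck_on_const)

lemma Cinf_on_id: "open S \<Longrightarrow> Cinf_on S (\<lambda>x. x)"
  by (simp add: Cinf_on_def Ck_on_id)

lemma Cinf_on_bounded_linear: "bounded_linear L \<Longrightarrow> Cinf_on S f \<Longrightarrow> Cinf_on S (\<lambda>x. L (f x))"
  by (simp add: Cinf_on_def Ck_on_bounded_linear)

lemma Cinf_on_bilinear:
  "bounded_bilinear h \<Longrightarrow> Cinf_on S f \<Longrightarrow> Cinf_on S g \<Longrightarrow> Cinf_on S (\<lambda>x. h (f x) (g x))"
  by (simp add: Cinf_on_def Ck_on_bilinear)

lemma Cinf_on_add: "Cinf_on S f \<Longrightarrow> Cinf_on S g \<Longrightarrow> Cinf_on S (\<lambda>x. f x + g x)"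
  by (simp add: Cinf_on_def Ck_on_add)

lemma Cinf_on_diff: "Cinf_on S f \<Longrightarrow> Cinf_on S g \<Longrightarrow> Cinf_on S (\<lambda>x. f x - g x)"
  using Cinf_on_add[OF _ Cinf_on_bounded_linear[OF bounded_linear_minus[OF bounded_linear_ident]], of S f g]
  by simp

lemma Cinf_on_sum:
  "open S \<Longrightarrow> (\<And>i. i \<in> I \<Longrightarrow> Cinf_on S (f i)) \<Longrightarrow> Cinf_on S (\<lambda>x. \<Sum>i\<in>I. f i x)"
  by (simp add: Cinf_on_def Ck_on_sum)

lemma Cinf_on_compose:
  fixes f :: "'a::euclidean_space \<Rightarrow> 'b::euclidean_space"
  shows "Cinf_on S f \<Longrightarrow> Cinf_on T g \<Longrightarrow> f ` S \<subseteq> T \<Longrightarrow> Cinf_on S (\<lambda>x. g (f x))"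
  by (simp add: Cinf_on_def Ck_on_compose)

lemmas Cinf_on_scaleR = Cinf_on_bilinear[OF bounded_bilinear_scaleR]
  and Cinf_on_mult = Cinf_on_bilinear[OF bounded_bilinear_mult]
  and Cinf_on_inner = Cinf_on_bilinear[OF bounded_bilinear_inner]

lemma Cinf_on_power:
  fixes f :: "'a::euclidean_space \<Rightarrow> real"
  shows "Cinf_on S f \<Longrightarrow> Cinf_on S (\<lambda>x. f x ^ n)"
  by (induction n) (auto intro: Cinf_on_mult Cinf_on_const Cinf_on_open)

lemma Cinf_on_powr:
  fixes f :: "'a::euclidean_space \<Rightarrow> real"
  assumes "Cinf_on S f" "\<And>x. x \<in> S \<Longrightarrow> f x > 0"
  shows "Cinf_on S (\<lambda>x. f x powr a)"
  by (rule Cinf_on_compose[OF assms(1), of "{0<..}"]) (auto simp: Cinf_on_def Ck_on_powr assms(2))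

lemma Cinf_on_inverse:
  fixes f :: "'a::euclidean_space \<Rightarrow> real"
  assumes "Cinf_on S f" "\<And>x. x \<in> S \<Longrightarrow> f x > 0"
  shows "Cinf_on S (\<lambda>x. inverse (f x))"
  by (rule Cinf_on_cong[OF Cinf_on_powr[OF assms, of "-1"]])
    (use assms(2) in \<open>auto simp: powr_minus less_imp_le\<close>)

lemma Cinf_on_norm:
  fixes f :: "'a::euclidean_space \<Rightarrow> 'b::real_inner"
  assumes "Cinf_on S f" "\<And>x. x \<in> S \<Longrightarrow> f x \<noteq> 0"
  shows "Cinf_on S (\<lambda>x. norm (f x))"
  by (rule Cinf_on_cong[OF Cinf_on_powr[OF Cinf_on_inner[OF assms(1) assms(1)], of "1/2"]])
    (auto simp: assms(2) norm_eq_sqrt_inner powr_half_sqrt)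

section \<open>Division by the boundary defining function\<close>

lemma segment_point_in_convex:
  assumes "convex B" "x \<in> B" "y \<in> B" "t \<in> {0..1::real}"
  shows "x + t *\<^sub>R (y - x) \<in> B"
proof -
  have "x + t *\<^sub>R (y - x) = (1 - t) *\<^sub>R x + t *\<^sub>R y" by (simp add: algebra_simps)
  then show ?thesis using convexD_alt[of B x y t] assms by auto
qed

lemma continuous_on_segment_integrand:
  fixes F :: "'a::euclidean_space \<Rightarrow> 'b::real_normed_vector" and w :: "real \<Rightarrow> real"
  assumes "convex B" "continuous_on B F" "continuous_on UNIV w"
  shows "continuous_on ((B \<times> B) \<times> cbox 0 1) (\<lambda>(z, t). w t *\<^sub>R F (fst z + t *\<^sub>R (snd z - fst z)))"
proof -
  have "continuous_on ((B \<times> B) \<times> cbox 0 1) (\<lambda>u. F (fst (fst u) + snd u *\<^sub>R (snd (fst u) - fst (fst u))))"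
    by (rule continuous_on_compose2[OF assms(2)])
      (auto intro!: continuous_intros segment_point_in_convex[OF assms(1)] simp del: scaleR_right_diff_distrib)
  moreover have "continuous_on ((B \<times> B) \<times> cbox 0 1) (\<lambda>u. w (snd u))"
    by (rule continuous_on_compose2[OF assms(3)]) (auto intro!: continuous_intros)
  ultimately show ?thesis
    by (simp add: case_prod_beta continuous_on_scaleR)
qed

lemma integrable_on_segment_integrand:
  fixes F :: "'a::euclidean_space \<Rightarrow> 'b::banach" and w :: "real \<Rightarrow> real"
  assumes "convex B" "continuous_on B F" "continuous_on UNIV w" "z \<in> B \<times> B"
  shows "(\<lambda>t. w t *\<^sub>R F (fst z + t *\<^sub>R (snd z - fst z))) integrable_on cbox 0 1"
proof (rule integrable_continuous)
  have "continuous_on (cbox 0 (1::real)) (Pair z)" by (intro continuous_intros)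
  then show "continuous_on (cbox 0 1) (\<lambda>t. w t *\<^sub>R F (fst z + t *\<^sub>R (snd z - fst z)))"
    using continuous_on_compose2[OF continuous_on_segment_integrand[OF assms(1-3)], of "cbox 0 1" "Pair z"]
      assms(4) by (simp add: image_subset_iff)
qed

text \<open>Differentiating in the two end points multiplies the integrand by \<open>1 - t\<close>
  and \<open>t\<close>, so the induction has to range over all continuous weights \<open>w\<close>.
  Convexity keeps the segments inside \<open>B\<close>.\<close>

lemma Ck_on_segment_integral:
  fixes F :: "'a::euclidean_space \<Rightarrow> 'b::banach" and w :: "real \<Rightarrow> real"
  assumes "open B" "convex B" "Ck_on k B F" "continuous_on UNIV w"
  shows "Ck_on k (B \<times> B) (\<lambda>z. integral (cbox 0 1) (\<lambda>t. w t *\<^sub>R F (fst z + t *\<^sub>R (snd z - fst z))))"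
  using assms(3,4)
proof (induction k arbitrary: F w)
  case 0
  then show ?case
    using integral_continuous_on_param[OF continuous_on_segment_integrand[OF assms(2)]] by simp
next
  case (Suc k)
  define c where "c = (\<lambda>(z :: 'a \<times> 'a) t. fst z + t *\<^sub>R (snd z - fst z))"
  define D where "D = (\<lambda>x. frechet_derivative F (at x))"
  have DF: "(F has_derivative D x) (at x)" if "x \<in> B" for x
    unfolding D_def by (rule Ck_on_Suc_has_derivative[OF Suc.prems(1) that])
  have linD: "bounded_linear (D x)" if "x \<in> B" for x
    by (rule has_derivative_bounded_linear[OF DF[OF that]])
  have CkD: "Ck_on k B (\<lambda>x. D x v)" for v using Suc.prems(1) by (simp add: D_def)
  note contD = CkD[THEN Ck_on_imp_continuous_on]
  have cB: "c z t \<in> B" if "z \<in> B \<times> B" "t \<in> cbox 0 1" for z t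
    using segment_point_in_convex[OF assms(2), of "fst z" "snd z" t] that by (auto simp: c_def)
  have linc: "bounded_linear (\<lambda>p. c p t)" for t
    unfolding c_def by (intro bounded_linear_intros)
  \<comment> \<open>The Leibniz rule wants the derivative as a bounded operator depending
    continuously on \<open>(z, t)\<close>; in finite dimension this can be checked on fixed
    vectors.\<close>
  define fx where "fx = (\<lambda>z t. Blinfun (\<lambda>p. w t *\<^sub>R D (c z t) (c p t)))"
  have fx: "blinfun_apply (fx z t) = (\<lambda>p. w t *\<^sub>R D (c z t) (c p t))"
    if "z \<in> B \<times> B" "t \<in> cbox 0 1" for z t
    unfolding fx_def
    by (rule bounded_linear_Blinfun_apply)
      (intro bounded_linear_scaleR_right[THEN bounded_linear_compose]
        bounded_linear_compose[OF linD[OF cB[OF that]] linc])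
  have split: "blinfun_apply (fx z t) p =
      (w t * (1 - t)) *\<^sub>R D (c z t) (fst p) + (w t * t) *\<^sub>R D (c z t) (snd p)"
    if "z \<in> B \<times> B" "t \<in> cbox 0 1" for z t p
  proof -
    interpret bounded_linear "D (c z t)" by (rule linD[OF cB[OF that]])
    have "c p t = (1 - t) *\<^sub>R fst p + t *\<^sub>R snd p" by (simp add: c_def algebra_simps)
    then show ?thesis
      unfolding fx[OF that] by (simp only: add scaleR scaleR_add_right scaleR_scaleR)
  qed
  have w1: "continuous_on UNIV (\<lambda>t. w t * (1 - t))" and w2: "continuous_on UNIV (\<lambda>t. w t * t)"
    by (intro continuous_intros Suc.prems)+
  have contfx: "continuous_on ((B \<times> B) \<times> cbox 0 1) (\<lambda>(z, t). fx z t)"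
  proof (rule continuous_on_blinfun_componentwise)
    fix p :: "'a \<times> 'a"
    have "continuous_on ((B \<times> B) \<times> cbox 0 1)
      (\<lambda>u. (case u of (z, t) \<Rightarrow> (w t * (1 - t)) *\<^sub>R D (c z t) (fst p)) +
           (case u of (z, t) \<Rightarrow> (w t * t) *\<^sub>R D (c z t) (snd p)))"
      unfolding c_def
      by (intro continuous_on_add continuous_on_segment_integrand[OF assms(2)] contD w1 w2)
    then show "continuous_on ((B \<times> B) \<times> cbox 0 1) (\<lambda>u. blinfun_apply (case u of (z, t) \<Rightarrow> fx z t) p)"
      by (rule continuous_on_eq) (auto simp: split)
  qed
  have opn: "open (B \<times> B)" using assms(1) by (simp add: open_Times)
  let ?H = "\<lambda>w v z. integral (cbox 0 1) (\<lambda>t. w t *\<^sub>R D (c z t) v)"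
  show ?case
  proof (rule Ck_on_SucI[OF opn])
    fix z assume z: "z \<in> B \<times> B"
    have "((\<lambda>z. integral (cbox 0 1) (\<lambda>t. w t *\<^sub>R F (c z t))) has_derivative
        integral (cbox 0 1) (fx z)) (at z within B \<times> B)"
    proof (rule leibniz_rule[OF _ _ contfx z])
      fix z t assume zt: "z \<in> B \<times> B" "t \<in> cbox (0::real) 1"
      have "((\<lambda>p. c p t) has_derivative (\<lambda>p. c p t)) (at z within B \<times> B)"
        by (rule bounded_linear_imp_has_derivative[OF linc])
      then have "((\<lambda>z. F (c z t)) has_derivative (\<lambda>p. D (c z t) (c p t))) (at z within B \<times> B)"
        by (rule has_derivative_compose[where f = "\<lambda>p. c p t" and g = F, OF _ DF[OF cB[OF zt]]])
      then show "((\<lambda>z. w t *\<^sub>R F (c z t)) has_derivative blinfun_apply (fx z t)) (at z within B \<times> B)"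
        unfolding fx[OF zt] by (rule has_derivative_scaleR_right)
    next
      fix z assume "z \<in> B \<times> B"
      then show "(\<lambda>t. w t *\<^sub>R F (c z t)) integrable_on cbox 0 1"
        unfolding c_def
        by (intro integrable_on_segment_integrand[OF assms(2)] Suc.prems
            Ck_on_imp_continuous_on[OF Suc.prems(1)])
    qed (simp add: assms(2) convex_Times)
    moreover have "blinfun_apply (integral (cbox 0 1) (fx z)) =
        (\<lambda>p. ?H (\<lambda>t. w t * (1 - t)) (fst p) z + ?H (\<lambda>t. w t * t) (snd p) z)"
    proof
      fix p
      have Pc: "continuous_on (cbox 0 (1::real)) (Pair z)" by (intro continuous_intros)
      have "continuous_on (cbox 0 1) (fx z)"
        using continuous_on_compose2[OF contfx, of "cbox 0 1" "Pair z"] z Pc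
        by (simp add: image_subset_iff)
      then have "blinfun_apply (integral (cbox 0 1) (fx z)) p = integral (cbox 0 1) (\<lambda>t. blinfun_apply (fx z t) p)"
        by (intro blinfun_apply_integral integrable_continuous)
      also have "\<dots> = integral (cbox 0 1)
          (\<lambda>t. (w t * (1 - t)) *\<^sub>R D (c z t) (fst p) + (w t * t) *\<^sub>R D (c z t) (snd p))"
        by (rule integral_cong) (rule split[OF z])
      also have "\<dots> = ?H (\<lambda>t. w t * (1 - t)) (fst p) z + ?H (\<lambda>t. w t * t) (snd p) z"
        unfolding c_def
        by (intro integral_add integrable_on_segment_integrand[OF assms(2)] contD w1 w2 z)
      finally show "blinfun_apply (integral (cbox 0 1) (fx z)) p = \<dots>" .
    qed
    ultimately show "((\<lambda>z. integral (cbox 0 1) (\<lambda>t. w t *\<^sub>R F (fst z + t *\<^sub>R (snd z - fst z)))) has_derivative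
        (\<lambda>p. ?H (\<lambda>t. w t * (1 - t)) (fst p) z + ?H (\<lambda>t. w t * t) (snd p) z)) (at z)"
      using at_within_open[OF z opn] by (simp add: c_def)
  next
    fix p :: "'a \<times> 'a"
    show "Ck_on k (B \<times> B) (\<lambda>z. ?H (\<lambda>t. w t * (1 - t)) (fst p) z + ?H (\<lambda>t. w t * t) (snd p) z)"
      unfolding c_def by (intro Ck_on_add[OF opn] Suc.IH CkD w1 w2)
  qed
qed

section \<open>The defining function \<open>rho\<close> and limits at the sphere\<close>

lemma at_within_ball_neq_bot:
  fixes q :: "'a::euclidean_space"
  shows "q \<in> sphere 0 1 \<Longrightarrow> at q within ball 0 1 \<noteq> bot"
  by (simp add: trivial_limit_within islimpt_ball)

lemma Cinf_on_tendsto_within: "Cinf_on S f \<Longrightarrow> x \<in> S \<Longrightarrow> (f \<longlongrightarrow> f x) (at x within T)"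
  using continuous_at_imp_continuous_at_within[OF Cinf_on_isCont] by (simp add: continuous_within)

lemma rho_pos: "x \<in> ball 0 1 \<Longrightarrow> rho x > 0"
  by (simp add: rho_def power_less_one_iff abs_square_less_1)

lemma rho_sphere: "x \<in> sphere 0 1 \<Longrightarrow> rho x = 0"
  by (simp add: rho_def)

lemma Cinf_on_rho: "open S \<Longrightarrow> Cinf_on S rho"
proof -
  assume S: "open S"
  have "Cinf_on S (\<lambda>x. (1/2) *\<^sub>R (1 - x \<bullet> x))"
    by (intro Cinf_on_bounded_linear[OF bounded_linear_scaleR_right] Cinf_on_diff Cinf_on_const
        Cinf_on_inner Cinf_on_id S)
  then show ?thesis by (rule Cinf_on_cong) (simp add: rho_def power2_norm_eq_inner)
qed

text \<open>The bound is known only inside the ball; continuity carries it to \<open>q\<close>,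
  where \<open>rho\<close> vanishes. With \<open>C = 0\<close> this transports an identity from the
  interior to the sphere.\<close>

lemma Cinf_on_eq_zero_on_sphere:
  fixes F :: "real^'n::finite \<Rightarrow> 'b::real_normed_vector"
  assumes "Cinf_on S F" "q \<in> S" "q \<in> sphere 0 1" "l > 0"
    and "\<And>y. y \<in> S \<Longrightarrow> y \<in> ball 0 1 \<Longrightarrow> norm (F y) \<le> C * rho y ^ l"
  shows "F q = 0"
proof -
  have "((\<lambda>y. C * rho y ^ l) \<longlongrightarrow> C * rho q ^ l) (at q within ball 0 1)"
    by (intro tendsto_intros Cinf_on_tendsto_within[OF Cinf_on_rho[OF open_UNIV] UNIV_I])
  moreover have "((\<lambda>y. norm (F y)) \<longlongrightarrow> norm (F q)) (at q within ball 0 1)"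
    by (rule tendsto_norm[OF Cinf_on_tendsto_within[OF assms(1,2)]])
  moreover have "\<forall>\<^sub>F y in at q within ball 0 1. norm (F y) \<le> C * rho y ^ l"
    using assms(2,5) Cinf_on_open[OF assms(1)] unfolding eventually_at_topological by blast
  ultimately have "norm (F q) \<le> C * rho q ^ l"
    by (intro tendsto_le[OF at_within_ball_neq_bot[OF assms(3)]])
  then show ?thesis using rho_sphere[OF assms(3)] assms(4) by (simp add: zero_power)
qed

text \<open>Hadamard's lemma along the radial segment from \<open>y / |y|\<close> to \<open>y\<close>, using
  \<open>y - y / |y| = - 2 rho y / (|y| (1 + |y|)) y\<close>.\<close>

lemma Cinf_on_divide_rho:
  fixes F :: "real^'n::finite \<Rightarrow> 'b::banach"
  assumes p: "p \<in> sphere 0 1" and r: "0 < r" "r \<le> 1" and F: "Cinf_on (ball p r) F"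
    and zero: "\<And>y. y \<in> ball p r \<Longrightarrow> y \<in> sphere 0 1 \<Longrightarrow> F y = 0"
  shows "\<exists>\<phi>. Cinf_on (ball p (r/2)) \<phi> \<and> (\<forall>y\<in>ball p (r/2). F y = rho y *\<^sub>R \<phi> y)"
proof -
  \<comment> \<open>\<open>c\<close> is the radial projection to the sphere, \<open>H b\<close>
    averages the derivative of \<open>F\<close> along \<open>b\<close> over a segment (with the
    trivial weight 1), and \<open>a\<close> is chosen so that
    \<open>y - c y = (rho y * a y) *\<^sub>R y\<close>.\<close>
  define c where "c = (\<lambda>y :: real^'n. inverse (norm y) *\<^sub>R y)"
  define H where "H = (\<lambda>b z. integral (cbox 0 1)
    (\<lambda>t. 1 *\<^sub>R frechet_derivative F (at (fst z + t *\<^sub>R (snd z - fst z))) b))"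
  define a where "a = (\<lambda>y :: real^'n. - 2 * (inverse (norm y) * inverse (1 + norm y)))"
  define \<phi> where "\<phi> = (\<lambda>y. \<Sum>b\<in>Basis. (a y * (y \<bullet> b)) *\<^sub>R H b (c y, y))"
  \<comment> \<open>As \<open>r \<le> 1\<close>, the ball of radius \<open>r/2\<close> stays away
    from the origin, where the projection is singular.\<close>
  have y0: "norm y > 0" if "y \<in> ball p (r/2)" for y
  proof -
    have "norm p \<le> norm y + dist p y" using norm_triangle_sub[of p y] by (simp add: dist_norm)
    then show ?thesis using p that r by auto
  qed
  have c_sphere: "c y \<in> sphere 0 1" if "y \<in> ball p (r/2)" for y
    using y0[OF that] by (simp add: c_def)
  \<comment> \<open>The projection moves \<open>y\<close> by at most \<open>dist p y\<close>, since
    \<open>p\<close> lies on the sphere. This is why the radius is halved.\<close>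
  have c_ball: "c y \<in> ball p r" if "y \<in> ball p (r/2)" for y
  proof -
    have "c y - y = ((1 - norm y) * inverse (norm y)) *\<^sub>R y"
      using y0[OF that] by (simp add: c_def algebra_simps)
    then have "norm (c y - y) = \<bar>1 - norm y\<bar>"
      using y0[OF that] by (simp add: abs_mult)
    also have "\<dots> \<le> dist p y"
      using norm_triangle_ineq3[of p y] p by (simp add: dist_norm)
    finally have "dist p (c y) \<le> 2 * dist p y"
      using dist_triangle[of p "c y" y] by (simp add: dist_norm norm_minus_commute)
    then show ?thesis using that by simp
  qed
  have y_ball: "y \<in> ball p r" if "y \<in> ball p (r/2)" for y
    using that r by auto
  have cinf_norm: "Cinf_on (ball p (r/2)) norm"
    by (rule Cinf_on_norm[OF Cinf_on_id]) (use y0 in force)+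
  have cinf_c: "Cinf_on (ball p (r/2)) c"
    unfolding c_def by (intro Cinf_on_scaleR Cinf_on_inverse cinf_norm Cinf_on_id y0) auto
  have "Cinf_on (ball p (r/2)) (\<lambda>y. (c y, 0) + (0, y))"
    by (intro Cinf_on_add Cinf_on_bounded_linear[OF _ cinf_c] Cinf_on_bounded_linear[OF _ Cinf_on_id]
        bounded_linear_Pair bounded_linear_ident bounded_linear_zero) auto
  then have cinf_pair: "Cinf_on (ball p (r/2)) (\<lambda>y. (c y, y))"
    by simp
  have cinf_H: "Cinf_on (ball p r \<times> ball p r) (H b)" for b
    unfolding Cinf_on_def H_def
    by (intro conjI allI open_Times Ck_on_segment_integral continuous_on_const)
      (use Cinf_on_frechet_derivative[OF F, of b] in \<open>auto simp: Cinf_on_def\<close>)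
  have "Cinf_on (ball p (r/2)) (\<lambda>y. H b (c y, y))" for b
    by (rule Cinf_on_compose[OF cinf_pair cinf_H]) (use c_ball y_ball in auto)
  moreover have "Cinf_on (ball p (r/2)) a"
    unfolding a_def
    by (intro Cinf_on_mult Cinf_on_inverse cinf_norm Cinf_on_const Cinf_on_add y0)
      (use y0 in \<open>auto intro: add_pos_nonneg\<close>)
  ultimately have "Cinf_on (ball p (r/2)) \<phi>"
    unfolding \<phi>_def
    by (intro Cinf_on_sum Cinf_on_scaleR Cinf_on_mult Cinf_on_inner Cinf_on_id Cinf_on_const) auto
  moreover have "F y = rho y *\<^sub>R \<phi> y" if y: "y \<in> ball p (r/2)" for y
  proof -
    define g where "g = (\<lambda>t. c y + t *\<^sub>R (y - c y))"
    let ?D = "\<lambda>x. frechet_derivative F (at x)"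
    have gB: "g t \<in> ball p r" if "t \<in> {0..1}" for t
      unfolding g_def
      by (rule segment_point_in_convex[OF convex_ball c_ball[OF y] y_ball[OF y] that])
    \<comment> \<open>The segment starts on the sphere, where \<open>F\<close> vanishes, so the
      fundamental theorem returns \<open>F y\<close> itself.\<close>
    have "((\<lambda>t. ?D (g t) (y - c y)) has_integral F (g 1) - F (g 0)) {0..1}"
    proof (rule fundamental_theorem_of_calculus)
      fix t :: real assume t: "t \<in> {0..1}"
      have "(g has_vector_derivative (y - c y)) (at t within {0..1})"
        unfolding g_def by (auto intro!: derivative_eq_intros)
      then have "(F \<circ> g has_vector_derivative ?D (g t) (y - c y)) (at t within {0..1})"
        by (rule vector_derivative_diff_chain_within)
          (rule has_derivative_at_withinI[OF Cinf_on_has_derivative[OF F gB[OF t]]])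
      then show "((\<lambda>t. F (g t)) has_vector_derivative ?D (g t) (y - c y)) (at t within {0..1})"
        by (simp add: o_def)
    qed simp
    then have 0: "((\<lambda>t. ?D (g t) (y - c y)) has_integral F y) {0..1}"
      using zero[OF c_ball[OF y] c_sphere[OF y]] by (simp add: g_def)
    have "?D (g t) (y - c y) = (\<Sum>b\<in>Basis. (rho y * a y * (y \<bullet> b)) *\<^sub>R ?D (g t) b)"
      if "t \<in> {0..1}" for t
    proof -
      interpret bounded_linear "?D (g t)"
        by (rule has_derivative_bounded_linear[OF Cinf_on_has_derivative[OF F gB[OF that]]])
      have "rho y * a y = 1 - inverse (norm y)"
        using y0[OF y] add_pos_pos[OF zero_less_one y0[OF y]]
        by (simp add: rho_def a_def divide_simps) (simp add: algebra_simps power2_eq_square)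
      then have "y - c y = (rho y * a y) *\<^sub>R y"
        by (simp only: c_def scaleR_diff_left scaleR_one)
      then have "?D (g t) (y - c y) = (rho y * a y) *\<^sub>R ?D (g t) y"
        by (simp only: scaleR)
      also have "?D (g t) y = ?D (g t) (\<Sum>b\<in>Basis. (y \<bullet> b) *\<^sub>R b)"
        by (simp only: euclidean_representation)
      also have "\<dots> = (\<Sum>b\<in>Basis. (y \<bullet> b) *\<^sub>R ?D (g t) b)"
        by (simp only: sum scaleR)
      finally show ?thesis by (simp only: scaleR_sum_right scaleR_scaleR)
    qed
    then have 1: "((\<lambda>t. \<Sum>b\<in>Basis. (rho y * a y * (y \<bullet> b)) *\<^sub>R ?D (g t) b) has_integral F y) {0..1}"
      by (rule has_integral_eq[OF _ 0])
    have "((\<lambda>t. ?D (g t) b) has_integral H b (c y, y)) {0..1}" for b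
      using integrable_on_segment_integrand[of "ball p r" "\<lambda>x. ?D x b" "\<lambda>_. 1" "(c y, y)"]
        Cinf_on_continuous[OF Cinf_on_frechet_derivative[OF F]] c_ball[OF y] y_ball[OF y]
      by (simp add: H_def g_def has_integral_integral)
    then have "((\<lambda>t. \<Sum>b\<in>Basis. (rho y * a y * (y \<bullet> b)) *\<^sub>R ?D (g t) b) has_integral
        (\<Sum>b\<in>Basis. (rho y * a y * (y \<bullet> b)) *\<^sub>R H b (c y, y))) {0..1}"
      by (intro has_integral_sum has_integral_cmul) auto
    then have "F y = (\<Sum>b\<in>Basis. (rho y * a y * (y \<bullet> b)) *\<^sub>R H b (c y, y))"
      by (rule has_integral_unique[OF 1])
    then show ?thesis by (simp add: \<phi>_def scaleR_sum_right mult.assoc)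
  qed
  ultimately show ?thesis by blast
qed

text \<open>Each division uses up one order of the bound: \<open>rho\<close> is positive inside the
  ball, so dividing the estimate leaves one of order \<open>l\<close> for the quotient, which again
  vanishes on the sphere as long as the remaining order is positive.\<close>

lemma Cinf_on_divide_rho_power:
  fixes F :: "real^'n::finite \<Rightarrow> 'b::banach"
  assumes "p \<in> sphere 0 1" "0 < r" "Cinf_on (ball p r) F"
    and "\<And>y. y \<in> ball p r \<Longrightarrow> y \<in> ball 0 1 \<Longrightarrow> norm (F y) \<le> C * rho y ^ l"
  shows "\<exists>s \<phi>. 0 < s \<and> s \<le> r \<and> Cinf_on (ball p s) \<phi> \<and> (\<forall>y\<in>ball p s. F y = rho y ^ l *\<^sub>R \<phi> y)"
  using assms(2-)
proof (induction l arbitrary: F r)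
  case 0
  then show ?case by (intro exI[of _ r] exI[of _ F]) auto
next
  case (Suc l)
  have zero: "F q = 0" if q: "q \<in> ball p r" "q \<in> sphere 0 1" for q
    by (rule Cinf_on_eq_zero_on_sphere[OF Suc.prems(2) q zero_less_Suc Suc.prems(3)])
  \<comment> \<open>A single division is available for radii at most 1 and halves the
    radius.\<close>
  define s where "s = min r 1"
  have s: "0 < s" "s \<le> 1" "ball p s \<subseteq> ball p r" using Suc.prems(1) by (auto simp: s_def)
  obtain \<phi> where \<phi>: "Cinf_on (ball p (s/2)) \<phi>" "\<And>y. y \<in> ball p (s/2) \<Longrightarrow> F y = rho y *\<^sub>R \<phi> y"
    using Cinf_on_divide_rho[OF assms(1) s(1,2), of F]
      Cinf_on_subset[OF Suc.prems(2) open_ball s(3)] zero s(3) by blast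
  have bd: "norm (\<phi> y) \<le> C * rho y ^ l" if "y \<in> ball p (s/2)" "y \<in> ball 0 1" for y
  proof -
    have "y \<in> ball p r" using that Suc.prems(1) by (auto simp: s_def)
    then have "rho y * norm (\<phi> y) \<le> rho y * (C * rho y ^ l)"
      using Suc.prems(3)[of y] that \<phi>(2)[OF that(1)] rho_pos[OF that(2)] by (simp add: mult_ac)
    then show ?thesis using rho_pos[OF that(2)] by simp
  qed
  obtain s' \<psi> where "0 < s'" "s' \<le> s/2" "Cinf_on (ball p s') \<psi>"
      "\<And>y. y \<in> ball p s' \<Longrightarrow> \<phi> y = rho y ^ l *\<^sub>R \<psi> y"
    using Suc.IH[OF _ \<phi>(1) bd] s(1) by auto
  moreover from this have "ball p s' \<subseteq> ball p (s/2)" by auto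
  ultimately show ?case
    using \<phi>(2) s by (intro exI[of _ s'] exI[of _ \<psi>]) (auto simp: s_def subset_iff)
qed

section \<open>Diffeomorphisms fixing the sphere to high order\<close>

lemma eventually_near_infinity:
  "eventually P near_infinity \<longleftrightarrow> (\<exists>b<1. \<forall>x. b < norm x \<and> norm x < 1 \<longrightarrow> P x)"
  (is "?L \<longleftrightarrow> ?R")
proof
  assume ?L
  then obtain Q where Q: "eventually Q (at_left (1::real))" "\<And>x. Q (norm x) \<Longrightarrow> P x"
    unfolding near_infinity_def eventually_filtercomap by blast
  then obtain b where "b < 1" "\<And>y. b < y \<Longrightarrow> y < 1 \<Longrightarrow> Q y"
    using eventually_at_left[of 0 "1::real" Q] by auto
  then show ?R using Q(2) by blast
next
  assume ?R
  then obtain b where b: "b < 1" "\<And>x. b < norm x \<Longrightarrow> norm x < 1 \<Longrightarrow> P x" by blast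
  have "eventually (\<lambda>y. b < y \<and> y < 1) (at_left (1::real))"
    using eventually_at_left[of 0 "1::real" "\<lambda>y. b < y \<and> y < 1"] b(1) by auto
  then show ?L unfolding near_infinity_def eventually_filtercomap using b(2) by blast
qed

lemma nbhd_infinityD:
  "nbhd_infinity U \<Longrightarrow> \<exists>b<1. \<forall>x. b < norm x \<and> norm x < 1 \<longrightarrow> x \<in> U"
proof -
  assume "nbhd_infinity U"
  then obtain e where e: "e > 0" "ball 0 1 - cball 0 (1 - e) \<subseteq> U" by (auto simp: nbhd_infinity_def)
  then show ?thesis by (intro exI[of _ "1 - e"]) (auto simp: subset_iff)
qed

lemma collar_contains_half_ball:
  assumes "q \<in> sphere 0 1" "b < 1"
  shows "\<exists>s>0. \<forall>y\<in>ball q s. y \<in> ball 0 1 \<longrightarrow> b < norm y \<and> norm y < 1"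
proof (intro exI[of _ "1 - b"] conjI ballI impI)
  fix y assume "y \<in> ball q (1 - b)"
  then show "b < norm y"
    using norm_triangle_sub[of q y] assms(1) by (simp add: dist_norm)
qed (use assms in auto)

lemma smooth_onE:
  assumes "smooth_on A f" "p \<in> A"
  obtains r F where "r > 0" "Cinf_on (ball p r) F" "\<And>x. x \<in> A \<Longrightarrow> x \<in> ball p r \<Longrightarrow> F x = f x"
proof -
  obtain W F where W: "open W" "p \<in> W" "\<forall>k. Ck_on k W F" "\<forall>x\<in>A \<inter> W. F x = f x"
    using assms unfolding smooth_on_def by blast
  then obtain r where "r > 0" "ball p r \<subseteq> W" using open_contains_ball by blast
  moreover from this W have "Cinf_on (ball p r) F" by (auto simp: Cinf_on_def intro: Ck_on_subset)
  ultimately show ?thesis using W(4) that by blast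
qed

lemma rho_le_gap: "rho x \<le> 1 - norm x"
  using zero_le_square[of "1 - norm x"] by (simp add: rho_def power2_eq_square field_simps)

text \<open>The gradient of \<open>rho\<close> at \<open>x\<close> is \<open>- x\<close>, of length
  below 1 in the ball. This compares \<open>rho\<close> at a point and at its image.\<close>

lemma rho_diff_le:
  assumes "norm x < 1" "norm y < 1"
  shows "\<bar>rho x - rho y\<bar> \<le> norm (x - y)"
proof -
  have "rho x - rho y = (norm y - norm x) * ((norm x + norm y) / 2)"
    by (simp add: rho_def power2_eq_square field_simps)
  then have "\<bar>rho x - rho y\<bar> = \<bar>norm y - norm x\<bar> * ((norm x + norm y) / 2)"
    by (simp only: abs_mult) simp
  also have "\<dots> \<le> \<bar>norm y - norm x\<bar> * 1"
    using assms by (intro mult_left_mono) auto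
  also have "\<dots> \<le> norm (x - y)"
    using norm_triangle_ineq3[of x y] by (simp add: abs_minus_commute)
  finally show ?thesis .
qed

text \<open>Merges three conditions near infinity into one collar; \<open>rho\<close> is positive
  there, so the absolute values of the Landau bound disappear.\<close>

lemma I0_collar_bound:
  assumes "(V, \<Theta>) \<in> I0 l"
  obtains C b where "C > 0" "b < 1"
    "\<And>x. b < norm x \<Longrightarrow> norm x < 1 \<Longrightarrow> x \<in> V \<and> x \<in> \<Theta> ` V \<and> norm (\<Theta> x - x) \<le> C * rho x ^ l"
proof -
  have N: "nbhd_infinity V" "nbhd_infinity (\<Theta> ` V)" "(\<lambda>x. norm (\<Theta> x - x)) \<in> O[near_infinity](\<lambda>x. rho x ^ l)"
    using assms by (auto simp: I0_def)
  obtain C where C: "C > 0" "\<forall>\<^sub>F x in near_infinity. norm (norm (\<Theta> x - x)) \<le> C * norm (rho x ^ l)"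
    using landau_o.bigE[OF N(3)] by blast
  obtain b1 where b1: "b1 < 1" "\<And>x. b1 < norm x \<Longrightarrow> norm x < 1 \<Longrightarrow> norm (\<Theta> x - x) \<le> C * \<bar>rho x ^ l\<bar>"
    using C(2) by (auto simp: eventually_near_infinity)
  obtain b2 where b2: "b2 < 1" "\<And>x. b2 < norm x \<Longrightarrow> norm x < 1 \<Longrightarrow> x \<in> V"
    using nbhd_infinityD[OF N(1)] by blast
  obtain b3 where b3: "b3 < 1" "\<And>x. b3 < norm x \<Longrightarrow> norm x < 1 \<Longrightarrow> x \<in> \<Theta> ` V"
    using nbhd_infinityD[OF N(2)] by blast
  show ?thesis
  proof (rule that[of C "max b1 (max b2 b3)"])
    fix x :: "real^'a" assume x: "max b1 (max b2 b3) < norm x" "norm x < 1"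
    then have "\<bar>rho x ^ l\<bar> = rho x ^ l" using rho_pos[of x] by simp
    then show "x \<in> V \<and> x \<in> \<Theta> ` V \<and> norm (\<Theta> x - x) \<le> C * rho x ^ l"
      using x b1(2)[of x] b2(2)[of x] b3(2)[of x] by auto
  qed (use C b1 b2 b3 in auto)
qed

text \<open>\<open>I0\<close> preserves the sphere only as a set; the decay of
  \<open>\<Theta> x - x\<close>, continued to the boundary, fixes each of its points.\<close>

lemma I0_fixes_sphere:
  assumes "(V, \<Theta>) \<in> I0 l" "l > 0" "q \<in> sphere 0 1"
  shows "\<Theta> q = q"
proof -
  obtain C b where b: "C > 0" "b < 1"
    "\<And>x. b < norm x \<Longrightarrow> norm x < 1 \<Longrightarrow> x \<in> V \<and> x \<in> \<Theta> ` V \<and> norm (\<Theta> x - x) \<le> C * rho x ^ l"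
    using I0_collar_bound[OF assms(1)] by metis
  have q: "q \<in> with_boundary V" using assms(3) by (simp add: with_boundary_def)
  obtain r F where F: "r > 0" "Cinf_on (ball q r) F" "\<And>x. x \<in> with_boundary V \<Longrightarrow> x \<in> ball q r \<Longrightarrow> F x = \<Theta> x"
    using smooth_onE[OF _ q] assms(1) unfolding I0_def by blast
  obtain s where s: "s > 0" "\<And>y. y \<in> ball q s \<Longrightarrow> y \<in> ball 0 1 \<Longrightarrow> b < norm y \<and> norm y < 1"
    using collar_contains_half_ball[OF assms(3) b(2)] by blast
  have "Cinf_on (ball q (min r s)) (\<lambda>x. F x - x)"
    by (intro Cinf_on_diff Cinf_on_id Cinf_on_subset[OF F(2)]) auto
  moreover have "norm (F y - y) \<le> C * rho y ^ l" if "y \<in> ball q (min r s)" "y \<in> ball 0 1" for y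
    using that b(3)[of y] s(2)[of y] F(3)[of y] by (auto simp: with_boundary_def)
  ultimately have "F q - q = 0"
    using F(1) s(1) by (intro Cinf_on_eq_zero_on_sphere[where C = C, OF _ _ assms(3,2)]) auto
  then show ?thesis using F(3)[OF q] F(1) by simp
qed

text \<open>At interior points \<open>rho\<close> is invertible and \<open>\<phi>\<close> is defined
  by division. At the sphere the decay is first rewritten in terms of \<open>rho y\<close> with
  \<open>y = \<Theta> x\<close>; Hadamard division of a smooth extension of the inverse then
  produces \<open>\<phi>\<close>.\<close>

lemma I0_inverse_expansion:
  fixes V :: "(real^'n::finite) set"
  assumes \<Theta>: "(V, \<Theta>) \<in> I0 (Suc k)" "k > 0" and p: "p \<in> with_boundary (\<Theta> ` V)"
  defines "\<Psi> \<equiv> inv_into (with_boundary V) \<Theta>"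
  shows "\<exists>s>0. \<exists>\<phi>. Cinf_on (ball p s) \<phi> \<and>
    (\<forall>y\<in>ball p s. (y \<in> ball 0 1 \<longrightarrow> y \<in> \<Theta> ` V) \<and>
      (y \<in> with_boundary (\<Theta> ` V) \<longrightarrow> \<Psi> y = y + rho y ^ Suc k *\<^sub>R \<phi> y))"
proof -
  have N: "nbhd_infinity V" "nbhd_infinity (\<Theta> ` V)" "inj_on \<Theta> (with_boundary V)"
    "\<Theta> ` with_boundary V = with_boundary (\<Theta> ` V)"
    "smooth_on (\<Theta> ` with_boundary V) \<Psi>"
    using \<Theta>(1) by (auto simp: I0_def with_boundary_def \<Psi>_def image_Un)
  have \<Psi>\<Theta>: "\<Psi> (\<Theta> x) = x" if "x \<in> with_boundary V" for x
    unfolding \<Psi>_def using N(3) that by simp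
  have \<Psi>_sphere: "\<Psi> q = q" if "q \<in> sphere 0 1" for q
    using \<Psi>\<Theta>[of q] I0_fixes_sphere[OF \<Theta>(1) _ that] that by (simp add: with_boundary_def)
  obtain r F where F: "r > 0" "Cinf_on (ball p r) F"
    "\<And>y. y \<in> with_boundary (\<Theta> ` V) \<Longrightarrow> y \<in> ball p r \<Longrightarrow> F y = \<Psi> y"
    using smooth_onE[OF N(5)[unfolded N(4)] p] by blast
  show ?thesis
  proof (cases "p \<in> \<Theta> ` V")
    case True
    have "open (\<Theta> ` V)" "\<Theta> ` V \<subseteq> ball 0 1" using N(2) by (auto simp: nbhd_infinity_def)
    then obtain r' where r': "r' > 0" "ball p r' \<subseteq> \<Theta> ` V" "ball p r' \<subseteq> ball 0 1"
      using True open_contains_ball by (metis subset_trans)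
    define s where "s = min r r'"
    have pos: "rho y > 0" if "y \<in> ball p s" for y
      using that r' by (intro rho_pos) (auto simp: s_def subset_iff)
    define \<phi> where "\<phi> = (\<lambda>y. inverse (rho y) ^ Suc k *\<^sub>R (F y - y))"
    have "Cinf_on (ball p s) \<phi>"
      unfolding \<phi>_def
      by (intro Cinf_on_scaleR Cinf_on_power Cinf_on_inverse Cinf_on_rho Cinf_on_diff Cinf_on_id
          Cinf_on_subset[OF F(2)] pos) (auto simp: s_def)
    moreover have "\<Psi> y = y + rho y ^ Suc k *\<^sub>R \<phi> y" if "y \<in> ball p s" "y \<in> with_boundary (\<Theta> ` V)" for y
      using F(3)[OF that(2)] pos[OF that(1)] that(1)
      by (simp add: \<phi>_def s_def power_inverse del: power_Suc)
    moreover have "s > 0" "ball p s \<subseteq> \<Theta> ` V" using F(1) r' by (auto simp: s_def subset_iff)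
    ultimately show ?thesis by blast
  next
    case False
    then have p1: "p \<in> sphere 0 1" using p by (auto simp: with_boundary_def)
    obtain C b where b: "C > 0" "b < 1"
      "\<And>x. b < norm x \<Longrightarrow> norm x < 1 \<Longrightarrow> x \<in> V \<and> x \<in> \<Theta> ` V \<and> norm (\<Theta> x - x) \<le> C * rho x ^ Suc k"
      using I0_collar_bound[OF \<Theta>(1)] by metis
    \<comment> \<open>With \<open>rho x \<le> 1 - norm x\<close>, this threshold makes
      \<open>C * rho x ^ k\<close> at most \<open>1/2\<close>, so the displacement is at most half
      of \<open>rho x\<close>.\<close>
    define b' where "b' = max b (1 - 1 / (2 * C))"
    have b': "b' < 1" using b by (simp add: b'_def)
    obtain s1 where s1: "s1 > 0" "\<And>y. y \<in> ball p s1 \<Longrightarrow> y \<in> ball 0 1 \<Longrightarrow> b < norm y \<and> norm y < 1"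
      using collar_contains_half_ball[OF p1 b(2)] by blast
    \<comment> \<open>\<open>p\<close> is fixed, so by continuity the preimages of points near
      \<open>p\<close> lie beyond the threshold \<open>b'\<close>, where the estimate is
      available.\<close>
    have Fp: "F p = p" using F(3)[OF p] F(1) \<Psi>_sphere[OF p1] by simp
    have "isCont (\<lambda>y. norm (F y)) p"
      using Cinf_on_isCont[OF F(2), of p] F(1) by (intro isCont_norm) auto
    then have "((\<lambda>y. norm (F y)) \<longlongrightarrow> norm (F p)) (nhds p)"
      using tendsto_at_iff_tendsto_nhds[of "\<lambda>y. norm (F y)" p] by (simp only: isCont_def)
    then have "\<forall>\<^sub>F y in nhds p. b' < norm (F y)"
      using b' Fp p1 by (intro order_tendstoD(1)) auto
    then obtain s2 where s2: "s2 > 0" "\<And>y. y \<in> ball p s2 \<Longrightarrow> b' < norm (F y)"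
      by (auto simp: eventually_nhds_metric dist_commute)
    define s where "s = min r (min s1 s2)"
    have s: "0 < s" "ball p s \<subseteq> ball p r" "ball p s \<subseteq> ball p s1" "ball p s \<subseteq> ball p s2"
      using F(1) s1 s2 by (auto simp: s_def)
    have sV: "y \<in> \<Theta> ` V" if "y \<in> ball p s" "y \<in> ball 0 1" for y
      using that s1(2)[of y] b(3)[of y] s(3) by blast
    have bound: "norm (F y - y) \<le> (C * 2 ^ Suc k) * rho y ^ Suc k" if y: "y \<in> ball p s" "y \<in> ball 0 1" for y
    proof -
      obtain x where x: "x \<in> V" "y = \<Theta> x" using sV[OF y] by blast
      have Fx: "F y = x"
        using F(3)[of y] sV[OF y] y(1) s(2) \<Psi>\<Theta>[of x] x by (auto simp: with_boundary_def)
      have nx: "norm x < 1" using N(1) x(1) by (auto simp: nbhd_infinity_def)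
      have ny: "norm y < 1" using y(2) by simp
      have bx: "b' < norm x" using s2(2)[of y] y(1) s(4) Fx by auto
      have est: "norm (y - x) \<le> C * rho x ^ Suc k"
        using b(3)[of x] bx nx x(2) by (simp add: b'_def)
      have r0: "rho x > 0" using nx by (intro rho_pos) simp
      have gap: "rho x \<le> 1 - norm x" by (rule rho_le_gap)
      then have "rho x \<le> 1" using norm_ge_zero[of x] by linarith
      then have "rho x ^ k \<le> rho x" using power_decreasing[of 1 k "rho x"] r0 \<open>k > 0\<close> by simp
      also have "rho x \<le> 1 / (2 * C)" using gap bx by (simp add: b'_def)
      finally have "C * rho x ^ k \<le> 1/2" using b(1) by (simp add: field_simps)
      then have "rho x * (C * rho x ^ k) \<le> rho x * (1/2)" using r0 by (intro mult_left_mono) auto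
      then have "norm (y - x) \<le> rho x / 2" using est by (simp add: mult_ac)
      \<comment> \<open>The Lipschitz bound gives \<open>rho x \<le> rho y + rho x / 2\<close>; this
        is the source of \<open>2 ^ Suc k\<close> in the constant.\<close>
      then have "rho x \<le> 2 * rho y" using rho_diff_le[OF nx ny] by (simp add: norm_minus_commute abs_le_iff)
      then have "rho x ^ Suc k \<le> (2 * rho y) ^ Suc k" using r0 by (intro power_mono) auto
      then have "C * rho x ^ Suc k \<le> C * (2 * rho y) ^ Suc k" using b(1) by (intro mult_left_mono) auto
      then show ?thesis
        using est Fx by (simp add: norm_minus_commute power_mult_distrib mult_ac)
    qed
    have "Cinf_on (ball p s) (\<lambda>y. F y - y)"
      by (intro Cinf_on_diff Cinf_on_id Cinf_on_subset[OF F(2)] s) auto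
    from Cinf_on_divide_rho_power[OF p1 s(1) this bound]
    obtain s' \<phi> where s': "0 < s'" "s' \<le> s" "Cinf_on (ball p s') \<phi>"
      "\<And>y. y \<in> ball p s' \<Longrightarrow> F y - y = rho y ^ Suc k *\<^sub>R \<phi> y" by blast
    have "\<Psi> y = y + rho y ^ Suc k *\<^sub>R \<phi> y" if "y \<in> ball p s'" "y \<in> with_boundary (\<Theta> ` V)" for y
    proof -
      have "F y = \<Psi> y" using F(3)[OF that(2)] that(1) s'(2) by (simp add: s_def)
      then show ?thesis using s'(4)[OF that(1)] by (simp add: algebra_simps)
    qed
    moreover have "ball p s' \<subseteq> ball p s" using s'(2) by auto
    ultimately show ?thesis using s' sV by blast
  qed
qed

section \<open>The rescaled pushforward\<close>

lemma transpose_eq_self_nth: "transpose A = A \<Longrightarrow> A $ i $ j = A $ j $ i"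
  by (drule arg_cong[where f = "\<lambda>A. A $ j $ i"]) (simp add: transpose_def)

definition outer_prod :: "real^'n \<Rightarrow> real^'n \<Rightarrow> real^'n^'n" where
  "outer_prod u v = (\<chi> i j. u $ i * v $ j)"

lemma outer_prod_nth [simp]: "outer_prod u v $ i $ j = u $ i * v $ j"
  by (simp add: outer_prod_def)

lemma outer_prod_mult_vec: "outer_prod u v *v w = (v \<bullet> w) *\<^sub>R (u :: real^'n::finite)"
  by (simp add: vec_eq_iff matrix_vector_mult_def inner_vec_def sum_distrib_left mult_ac)

lemma bounded_bilinear_outer_prod:
  "bounded_bilinear (outer_prod :: real^'n::finite \<Rightarrow> real^'n \<Rightarrow> real^'n^'n)"
  unfolding bilinear_conv_bounded_bilinear[symmetric] bilinear_def linear_iff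
  by (simp add: vec_eq_iff algebra_simps)

lemma bounded_bilinear_matrix_mult:
  "bounded_bilinear ((**) :: real^'n::finite^'n \<Rightarrow> real^'n^'n \<Rightarrow> real^'n^'n)"
  unfolding bilinear_conv_bounded_bilinear[symmetric] bilinear_def linear_iff
  by (simp add: vec_eq_iff matrix_matrix_mult_def sum.distrib sum_distrib_left algebra_simps)

lemma bounded_bilinear_matrix_vector_mult:
  "bounded_bilinear ((*v) :: real^'n::finite^'n \<Rightarrow> real^'n \<Rightarrow> real^'n)"
  unfolding bilinear_conv_bounded_bilinear[symmetric] bilinear_def linear_iff
  by (simp add: vec_eq_iff matrix_vector_mult_def sum.distrib sum_distrib_left algebra_simps)

lemma bounded_linear_transpose:
  "bounded_linear (transpose :: real^'n::finite^'n \<Rightarrow> real^'n^'n)"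
  unfolding linear_conv_bounded_linear[symmetric] linear_iff
  by (simp add: vec_eq_iff transpose_def)

text \<open>The Jacobian is the sum of its columns paired with axis vectors, which reduces the claim
  to directional derivatives along the axes.\<close>

lemma Cinf_on_matrix_frechet_derivative:
  fixes f :: "real^'n::finite \<Rightarrow> real^'n"
  assumes "Cinf_on S f"
  shows "Cinf_on S (\<lambda>x. matrix (frechet_derivative f (at x)))"
proof -
  have "matrix (frechet_derivative f (at x)) =
    (\<Sum>j\<in>UNIV. outer_prod (frechet_derivative f (at x) (axis j 1)) (axis j 1))" for x
    by (simp add: vec_eq_iff matrix_def axis_def if_distrib cong: if_cong)
  moreover have "Cinf_on S (\<lambda>x. \<Sum>j\<in>UNIV. outer_prod (frechet_derivative f (at x) (axis j 1)) (axis j 1))"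
    by (intro Cinf_on_sum Cinf_on_bilinear[OF bounded_bilinear_outer_prod] Cinf_on_frechet_derivative
        Cinf_on_const assms Cinf_on_open[OF assms])
  ultimately show ?thesis by simp
qed

text \<open>Exact in \<open>c\<close>: the bracket is polynomial, so with
  \<open>c = rho y ^ k\<close> and smooth \<open>K\<close>, \<open>N\<close> it stays smooth across
  the sphere.\<close>

lemma congruence_expansion:
  fixes K N :: "real^'n::finite^'n"
  shows "transpose (mat 1 + c *\<^sub>R K) ** (mat 1 + c *\<^sub>R N) ** (mat 1 + c *\<^sub>R K)
    = mat 1 + c *\<^sub>R (K + transpose K + c *\<^sub>R (transpose K ** K)
        + transpose (mat 1 + c *\<^sub>R K) ** N ** (mat 1 + c *\<^sub>R K))"
proof -
  interpret mm: bounded_bilinear "(**) :: real^'n^'n \<Rightarrow> real^'n^'n \<Rightarrow> real^'n^'n"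
    by (rule bounded_bilinear_matrix_mult)
  interpret tr: bounded_linear "transpose :: real^'n^'n \<Rightarrow> real^'n^'n"
    by (rule bounded_linear_transpose)
  show ?thesis
    by (simp add: mm.add_left mm.add_right mm.scaleR_left mm.scaleR_right tr.add tr.scaleR
        scaleR_add_right transpose_mat)
qed

text \<open>Here \<open>c\<close> and \<open>r\<close> are the values of \<open>rho ^ k\<close> and \<open>rho\<close> at \<open>y\<close>, \<open>J = 1 + c K\<close> is the
  Jacobian of the inverse diffeomorphism, \<open>r (1 - c s)\<close> is \<open>rho\<close> at the preimage of \<open>y\<close>.\<close>

lemma rescaled_pullback_expansion:
  fixes K N g :: "real^'n::finite^'n"
  assumes "r > 0" "c \<noteq> 0" "1 - c * s > 0"
    and g: "g = (1 / (r * (1 - c * s))\<^sup>2) *\<^sub>R (mat 1 + c *\<^sub>R N)"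
  defines "J \<equiv> mat 1 + c *\<^sub>R K"
  shows "(1 / c) *\<^sub>R (r\<^sup>2 *\<^sub>R (transpose J ** g ** J) - mat 1) =
    (s * (2 - c * s) * inverse (1 - c * s) ^ 2) *\<^sub>R (transpose J ** (mat 1 + c *\<^sub>R N) ** J)
    + (K + transpose K + c *\<^sub>R (transpose K ** K) + transpose J ** N ** J)"
proof -
  interpret mm: bounded_bilinear "(**) :: real^'n^'n \<Rightarrow> real^'n^'n \<Rightarrow> real^'n^'n"
    by (rule bounded_bilinear_matrix_mult)
  define M where "M = transpose J ** (mat 1 + c *\<^sub>R N) ** J"
  define R where "R = K + transpose K + c *\<^sub>R (transpose K ** K) + transpose J ** N ** J"
  \<comment> \<open>Solves \<open>(1 - c * s)^(-2) = 1 + c * \<tau>\<close> without dividing by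
    \<open>c\<close>, so that it makes sense also on the sphere, where \<open>c\<close> becomes
    0.\<close>
  define \<tau> where "\<tau> = s * (2 - c * s) * inverse (1 - c * s) ^ 2"
  have M: "M = mat 1 + c *\<^sub>R R"
    unfolding M_def R_def J_def by (rule congruence_expansion)
  have "r\<^sup>2 * (1 / (r * (1 - c * s))\<^sup>2) = inverse ((1 - c * s)\<^sup>2)"
    using assms(1) by (simp add: power_mult_distrib divide_inverse)
  also have "\<dots> = 1 + c * \<tau>"
    using assms(3) by (simp add: \<tau>_def divide_simps power_inverse) (simp add: power2_eq_square algebra_simps)
  finally have *: "r\<^sup>2 * (1 / (r * (1 - c * s))\<^sup>2) = 1 + c * \<tau>" .
  have "r\<^sup>2 *\<^sub>R (transpose J ** g ** J) = (r\<^sup>2 * (1 / (r * (1 - c * s))\<^sup>2)) *\<^sub>R M"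
    unfolding g M_def by (simp only: mm.scaleR_left mm.scaleR_right scaleR_scaleR)
  then have "r\<^sup>2 *\<^sub>R (transpose J ** g ** J) - mat 1 = c *\<^sub>R (\<tau> *\<^sub>R M + R)"
    unfolding * by (simp add: scaleR_add_left scaleR_add_right) (simp add: M)
  then show ?thesis
    using assms(2) unfolding M_def[symmetric] R_def[symmetric] \<tau>_def[symmetric] by simp
qed

text \<open>\<open>rho\<close> is quadratic, so its second-order expansion is exact, and the factor
  \<open>rho y ^ Suc k\<close> of the shift lets \<open>rho y\<close> be pulled out.\<close>

lemma rho_radial_shift:
  fixes y f :: "real^'n::finite"
  shows "rho (y + rho y ^ Suc k *\<^sub>R f) = rho y * (1 - rho y ^ k * (y \<bullet> f + rho y ^ Suc k * (f \<bullet> f) / 2))"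
proof -
  have "rho (y + h *\<^sub>R f) = rho y - h * (y \<bullet> f) - h * h * (f \<bullet> f) / 2" for h
    by (simp add: rho_def power2_norm_eq_inner inner_add_left inner_add_right inner_commute[of f y]
        field_simps)
  from this[of "rho y ^ Suc k"] show ?thesis by (simp add: algebra_simps)
qed

lemma has_derivative_rho: "(rho has_derivative (\<lambda>v. - (y \<bullet> v))) (at y)"
proof -
  have "((\<lambda>x. (1 - x \<bullet> x) / 2) has_derivative (\<lambda>v. - (y \<bullet> v))) (at y)"
    by (auto intro!: derivative_eq_intros simp: inner_commute)
  moreover have "rho = (\<lambda>x :: real^'a. (1 - x \<bullet> x) / 2)"
    by (simp add: rho_def fun_eq_iff power2_norm_eq_inner)
  ultimately show ?thesis by simp
qed

text \<open>The rank-one term comes from differentiating \<open>rho ^ Suc k\<close>, the gradient of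
  \<open>rho\<close> being \<open>- y\<close>. This costs one power of \<open>rho\<close> and leaves
  \<open>rho y ^ k\<close> as the common factor.\<close>

lemma matrix_derivative_radial_shift:
  fixes \<phi> :: "real^'n::finite \<Rightarrow> real^'n"
  assumes "(\<phi> has_derivative \<phi>') (at y)"
  obtains D where "((\<lambda>y. y + rho y ^ Suc k *\<^sub>R \<phi> y) has_derivative D) (at y)"
    and "matrix D = mat 1 + rho y ^ k *\<^sub>R (rho y *\<^sub>R matrix \<phi>' - real (Suc k) *\<^sub>R outer_prod (\<phi> y) y)"
proof
  show "((\<lambda>y. y + rho y ^ Suc k *\<^sub>R \<phi> y) has_derivative
    (\<lambda>v. v + (rho y ^ Suc k *\<^sub>R \<phi>' v + (real (Suc k) * (- (y \<bullet> v)) * rho y ^ k) *\<^sub>R \<phi> y))) (at y)"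
    using has_derivative_power[OF has_derivative_rho, where n = "Suc k"]
    by (intro has_derivative_add has_derivative_ident has_derivative_scaleR assms) simp
  show "matrix (\<lambda>v. v + (rho y ^ Suc k *\<^sub>R \<phi>' v + (real (Suc k) * (- (y \<bullet> v)) * rho y ^ k) *\<^sub>R \<phi> y))
    = mat 1 + rho y ^ k *\<^sub>R (rho y *\<^sub>R matrix \<phi>' - real (Suc k) *\<^sub>R outer_prod (\<phi> y) y)"
  proof -
    have "axis j (1::real) $ i = (if i = j then 1 else 0)" for i j :: 'n by (simp add: axis_def)
    then show ?thesis by (simp add: vec_eq_iff matrix_def mat_def inner_axis algebra_simps)
  qed
qed

text \<open>Transversality determines the leading coefficient \<open>f\<close> of the adjustment diffeomorphism:
  \<open>f \<bullet> y = m(y,y) / (2 k)\<close> and \<open>(k + 1) f = m y + (1 - k) (f \<bullet> y) y\<close>.\<close>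

lemma transverse_leading_term:
  fixes m M :: "real^'n::finite^'n" and y f :: "real^'n"
  assumes k: "k > (0::nat)" and y: "y \<in> sphere 0 1" and sym: "transpose m = m"
    and M: "M = (2 * (y \<bullet> f)) *\<^sub>R mat 1 - real (Suc k) *\<^sub>R (outer_prod f y + outer_prod y f) + m"
    and tr: "\<And>w. y \<bullet> (M *v w) = 0"
  shows "M $ i $ j =
                m $ i $ j
                - (\<Sum>a\<in>UNIV. m $ a $ j * y $ a) * y $ i
                - (\<Sum>a\<in>UNIV. m $ i $ a * y $ a) * y $ j
                + (\<Sum>a\<in>UNIV. \<Sum>b\<in>UNIV. m $ a $ b * (y $ a * y $ b / real k))
                  * ((real k - 1) * y $ i * y $ j + (if i = j then 1 else 0))"
proof -
  interpret mv: bounded_bilinear "(*v) :: real^'n^'n \<Rightarrow> real^'n \<Rightarrow> real^'n"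
    by (rule bounded_bilinear_matrix_vector_mult)
  have yy: "y \<bullet> y = 1" using y by (simp add: norm_eq_1)
  have msym: "m $ a $ b = m $ b $ a" for a b
    by (rule transpose_eq_self_nth[OF sym])
  have Msym: "transpose M = M"
    unfolding M using msym by (simp add: vec_eq_iff transpose_def mat_def mult.commute)
  \<comment> \<open>By symmetry of \<open>M\<close>, the choice \<open>w = M *v y\<close> turns
    transversality into the vanishing of the squared norm of \<open>M *v y\<close>.\<close>
  have "M *v y = 0"
    using tr[of "M *v y"] Msym by (metis dot_lmul_matrix inner_eq_zero_iff transpose_matrix_vector)
  moreover have "M *v y = (2 * (y \<bullet> f)) *\<^sub>R y - real (Suc k) *\<^sub>R (f + (y \<bullet> f) *\<^sub>R y) + m *v y"
    using yy unfolding M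
    by (simp only: mv.add_left mv.diff_left mv.scaleR_left outer_prod_mult_vec matrix_vector_mul_lid
        inner_commute[of f y] scaleR_one)
  ultimately have "(2 * (y \<bullet> f)) *\<^sub>R y - real (Suc k) *\<^sub>R (f + (y \<bullet> f) *\<^sub>R y) + m *v y = 0"
    by simp
  then have "2 * (y \<bullet> f) * y $ i - real (Suc k) * (f $ i + (y \<bullet> f) * y $ i) + (m *v y) $ i = 0" for i
    by (simp add: vec_eq_iff del: of_nat_Suc)
  then have f: "real (Suc k) * f $ i = (m *v y) $ i + (1 - real k) * (y \<bullet> f) * y $ i" for i
    by (simp add: algebra_simps eq_diff_eq)
  then have fv: "real (Suc k) *\<^sub>R f = m *v y + ((1 - real k) * (y \<bullet> f)) *\<^sub>R y"
    by (simp add: vec_eq_iff)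
  \<comment> \<open>Pairing the vector identity with \<open>y\<close> gives
    \<open>2 k (y \<bullet> f) = \<mu>\<close>, the origin of the denominator \<open>k\<close> in
    the formula.\<close>
  define \<mu> where "\<mu> = y \<bullet> (m *v y)"
  have "real (Suc k) * (y \<bullet> f) = \<mu> + (1 - real k) * (y \<bullet> f)"
    using arg_cong[OF fv, of "inner y"] yy by (simp add: \<mu>_def inner_add_right)
  then have \<mu>: "y \<bullet> f = \<mu> / (2 * real k)"
    using k yy by (simp add: field_simps)
  have 1: "(\<Sum>a\<in>UNIV. m $ a $ j * y $ a) = (m *v y) $ j" "(\<Sum>a\<in>UNIV. m $ i $ a * y $ a) = (m *v y) $ i"
    by (simp_all add: matrix_vector_mult_def msym[of _ j])
  have 2: "(\<Sum>a\<in>UNIV. \<Sum>b\<in>UNIV. m $ a $ b * (y $ a * y $ b / real k)) = \<mu> / real k"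
    by (simp add: \<mu>_def inner_vec_def matrix_vector_mult_def sum_distrib_left sum_divide_distrib mult_ac)
  \<comment> \<open>Each rank-one term contributes \<open>(k - 1) / (2 k) * \<mu>\<close> times
    \<open>y $ i * y $ j\<close>; the two together give the coefficient
    \<open>(k - 1) / k\<close>.\<close>
  have "M $ i $ j = 2 * (y \<bullet> f) * (if i = j then 1 else 0)
     - (real (Suc k) * f $ i) * y $ j - (real (Suc k) * f $ j) * y $ i + m $ i $ j"
    by (simp add: M mat_def algebra_simps)
  also have "\<dots> = m $ i $ j - (m *v y) $ j * y $ i - (m *v y) $ i * y $ j
     + \<mu> / real k * ((real k - 1) * y $ i * y $ j + (if i = j then 1 else 0))"
    unfolding f \<mu> using k by (simp add: field_simps)
  finally show ?thesis unfolding 1 2 .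
qed

text \<open>Smoothness is a local matter, and interior points \<open>p\<close> are included because
  it is required on the whole domain. On the sphere only the shape of \<open>T\<close> is recorded:
  the vector \<open>f\<close> is a value of \<open>\<phi>\<close>, left for transversality to
  determine.\<close>

lemma pushforward_expansion_local:
  fixes U V :: "(real^'n::finite) set"
  assumes k: "k > 0" and \<Theta>: "(V, \<Theta>) \<in> I0 (Suc k)"
    and exp: "has_expansion k (U, g) m" and p: "p \<in> with_boundary (\<Theta> ` (U \<inter> V))"
  shows "\<exists>r>0. \<exists>T. Cinf_on (ball p r) T \<and>
    (\<forall>y\<in>ball p r. (y \<in> \<Theta> ` (U \<inter> V) \<longrightarrow>
        T y = (1 / rho y ^ k) *\<^sub>R ((rho y)\<^sup>2 *\<^sub>R snd (pushforward (V, \<Theta>) (U, g)) y - mat 1)) \<and>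
      (y \<in> sphere 0 1 \<longrightarrow>
        (\<exists>f. T y = (2 * (y \<bullet> f)) *\<^sub>R mat 1 - real (Suc k) *\<^sub>R (outer_prod f y + outer_prod y f) + m y)))"
proof -
  define \<Psi> where "\<Psi> = inv_into (with_boundary V) \<Theta>"
  have \<Psi>\<Theta>: "\<Psi> (\<Theta> x) = x" if "x \<in> with_boundary V" for x
    using \<Theta> that by (simp add: \<Psi>_def I0_def)
  have p': "p \<in> with_boundary (\<Theta> ` V)" using p by (auto simp: with_boundary_def)
  obtain s \<phi> where s: "s > 0" "Cinf_on (ball p s) \<phi>"
    "\<And>y. y \<in> ball p s \<Longrightarrow> y \<in> ball 0 1 \<Longrightarrow> y \<in> \<Theta> ` V"
    "\<And>y. y \<in> ball p s \<Longrightarrow> y \<in> with_boundary (\<Theta> ` V) \<Longrightarrow> \<Psi> y = y + rho y ^ Suc k *\<^sub>R \<phi> y"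
    using I0_inverse_expansion[OF \<Theta> k p'] unfolding \<Psi>_def by blast
  \<comment> \<open>\<open>E\<close> extends the inverse to a full ball, beyond the unit ball, in
    such a way that \<open>rho (E y) = rho y * q y\<close> holds identically.\<close>
  define E where "E = (\<lambda>y. y + rho y ^ Suc k *\<^sub>R \<phi> y)"
  define \<sigma> where "\<sigma> = (\<lambda>y. y \<bullet> \<phi> y + rho y ^ Suc k * (\<phi> y \<bullet> \<phi> y) / 2)"
  define q where "q = (\<lambda>y. 1 - rho y ^ k * \<sigma> y)"
  have rhoE: "rho (E y) = rho y * q y" for y
    unfolding E_def q_def \<sigma>_def by (rule rho_radial_shift)
  have cE: "Cinf_on (ball p s) E"
    unfolding E_def by (intro Cinf_on_add Cinf_on_id Cinf_on_scaleR Cinf_on_power Cinf_on_rho s(2)) auto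
  have "Cinf_on (ball p s) (\<lambda>y. y \<bullet> \<phi> y + (rho y ^ Suc k * (\<phi> y \<bullet> \<phi> y)) * (1/2))"
    by (intro Cinf_on_add Cinf_on_mult Cinf_on_inner Cinf_on_id Cinf_on_const Cinf_on_power Cinf_on_rho s(2)) auto
  then have c\<sigma>: "Cinf_on (ball p s) \<sigma>" by (simp add: \<sigma>_def)
  have cq: "Cinf_on (ball p s) q"
    unfolding q_def by (intro Cinf_on_diff Cinf_on_mult Cinf_on_const Cinf_on_power Cinf_on_rho c\<sigma>) auto
  have ps: "p \<in> ball p s" using s(1) by simp
  have UB: "U \<subseteq> ball 0 1" "V \<subseteq> ball 0 1" and \<Theta>B: "\<Theta> ` V \<subseteq> ball 0 1" "open (\<Theta> ` V)"
    using exp \<Theta> by (auto simp: has_expansion_def I0_def nbhd_infinity_def)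
  have E_eq: "E (\<Theta> x) = x" if "x \<in> V" "\<Theta> x \<in> ball p s" for x
    using s(4)[OF that(2)] \<Psi>\<Theta>[of x] that(1) by (simp add: E_def with_boundary_def)
  have E_sphere: "E y = y" if "y \<in> sphere 0 1" for y
    using rho_sphere[OF that] by (simp add: E_def)
  \<comment> \<open>On the sphere \<open>q\<close> is 1; at an interior point it is a quotient of
    two positive values of \<open>rho\<close>.\<close>
  have "E p \<in> with_boundary U \<and> q p > 0"
  proof (cases "p \<in> sphere 0 1")
    case True
    then show ?thesis
      using E_sphere[OF True] rho_sphere[OF True] k by (auto simp: with_boundary_def q_def zero_power)
  next
    case False
    then obtain x where x: "x \<in> U" "x \<in> V" "p = \<Theta> x" using p by (auto simp: with_boundary_def)
    then have "E p = x" using E_eq ps by simp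
    moreover have "rho x > 0" "rho p > 0" using x UB \<Theta>B by (auto intro!: rho_pos)
    ultimately show ?thesis
      using x rhoE[of p] by (auto simp: with_boundary_def zero_less_mult_iff)
  qed
  then have Ep: "E p \<in> with_boundary U" and qp: "q p > 0" by simp_all
  obtain T0 where T0: "smooth_on (with_boundary U) T0"
    "\<And>x. x \<in> U \<Longrightarrow> T0 x = (1 / rho x ^ k) *\<^sub>R ((rho x)\<^sup>2 *\<^sub>R g x - mat 1)"
    "\<And>x. x \<in> sphere 0 1 \<Longrightarrow> T0 x = m x"
    using exp unfolding has_expansion_def by blast
  obtain t F where F: "t > 0" "Cinf_on (ball (E p) t) F"
    "\<And>x. x \<in> with_boundary U \<Longrightarrow> x \<in> ball (E p) t \<Longrightarrow> F x = T0 x"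
    using smooth_onE[OF T0(1) Ep] by blast
  have "(E \<longlongrightarrow> E p) (nhds p)" "(q \<longlongrightarrow> q p) (nhds p)"
    using Cinf_on_isCont[OF cE ps] Cinf_on_isCont[OF cq ps]
      tendsto_at_iff_tendsto_nhds[of E p] tendsto_at_iff_tendsto_nhds[of q p] by (simp_all add: isCont_def)
  then have "\<forall>\<^sub>F y in nhds p. E y \<in> ball (E p) t" "\<forall>\<^sub>F y in nhds p. q y > 0"
    using F(1) qp topological_tendstoD[of E "E p" "nhds p" "ball (E p) t"] order_tendstoD(1)[of q "q p" "nhds p" 0]
    by simp_all
  then have "\<forall>\<^sub>F y in nhds p. E y \<in> ball (E p) t \<and> q y > 0" by (rule eventually_conj)
  then obtain r0 where r0: "r0 > 0" "\<And>y. y \<in> ball p r0 \<Longrightarrow> E y \<in> ball (E p) t \<and> q y > 0"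
    unfolding eventually_nhds_metric by (auto simp: dist_commute)
  define r where "r = min s r0"
  have r: "r > 0" "ball p r \<subseteq> ball p s" "ball p r \<subseteq> ball p r0" using s(1) r0(1) by (auto simp: r_def)
  note sub = Cinf_on_subset[OF _ open_ball r(2)]
  define K where "K = (\<lambda>y. rho y *\<^sub>R matrix (frechet_derivative \<phi> (at y)) - real (Suc k) *\<^sub>R outer_prod (\<phi> y) y)"
  \<comment> \<open>The factor \<open>q y ^ k\<close> converts the power of \<open>rho\<close> at
    the preimage into one at \<open>y\<close>: \<open>rho y ^ k *\<^sub>R N y\<close> is the
    deviation of the rescaled metric from the identity at \<open>E y\<close>.\<close>
  define N where "N = (\<lambda>y. q y ^ k *\<^sub>R F (E y))"
  define J where "J = (\<lambda>y. mat 1 + rho y ^ k *\<^sub>R K y)"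
  \<comment> \<open>The right-hand side of the algebraic expansion. Its only division is by
    \<open>q\<close>, which is positive on the small ball, so it crosses the sphere
    smoothly.\<close>
  define T where "T = (\<lambda>y. (\<sigma> y * (2 - rho y ^ k * \<sigma> y) * inverse (q y) ^ 2) *\<^sub>R
      (transpose (J y) ** (mat 1 + rho y ^ k *\<^sub>R N y) ** J y)
    + (K y + transpose (K y) + rho y ^ k *\<^sub>R (transpose (K y) ** K y) + transpose (J y) ** N y ** J y))"
  note mm = Cinf_on_bilinear[OF bounded_bilinear_matrix_mult]
  have crho: "Cinf_on (ball p r) rho" by (intro Cinf_on_rho) simp
  have cK: "Cinf_on (ball p r) K"
    unfolding K_def
    by (intro Cinf_on_diff Cinf_on_scaleR Cinf_on_matrix_frechet_derivative Cinf_on_const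
        Cinf_on_bilinear[OF bounded_bilinear_outer_prod] Cinf_on_id crho sub[OF s(2)]) auto
  have "Cinf_on (ball p r) (\<lambda>y. F (E y))"
    by (rule Cinf_on_compose[OF sub[OF cE] F(2)]) (use r0(2) r(3) in blast)
  then have cN: "Cinf_on (ball p r) N"
    unfolding N_def by (intro Cinf_on_scaleR Cinf_on_power sub[OF cq])
  have cJ: "Cinf_on (ball p r) J"
    unfolding J_def by (intro Cinf_on_add Cinf_on_const Cinf_on_scaleR Cinf_on_power crho cK) simp
  have qpos: "q y > 0" if "y \<in> ball p r" for y using that r0(2) r(3) by blast
  note ctr = Cinf_on_bounded_linear[OF bounded_linear_transpose]
  have "Cinf_on (ball p r) T"
    unfolding T_def
    by (intro Cinf_on_add Cinf_on_diff Cinf_on_scaleR Cinf_on_mult mm Cinf_on_const Cinf_on_power crho cK cN cJ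
        ctr Cinf_on_inverse sub[OF c\<sigma>] sub[OF cq] qpos) auto
  moreover have "T y = (1 / rho y ^ k) *\<^sub>R ((rho y)\<^sup>2 *\<^sub>R snd (pushforward (V, \<Theta>) (U, g)) y - mat 1)"
    if y: "y \<in> ball p r" "y \<in> \<Theta> ` (U \<inter> V)" for y
  proof -
    obtain x where x: "x \<in> U" "x \<in> V" "y = \<Theta> x" using y(2) by blast
    have ys: "y \<in> ball p s" using y(1) r(2) by blast
    have Ex: "E y = x" using E_eq[OF x(2)] x(3) ys by simp
    have \<Psi>y: "\<Psi> y = x" using \<Psi>\<Theta>[of x] x by (simp add: with_boundary_def)
    have pos: "rho x > 0" "rho y > 0" using x UB \<Theta>B by (auto intro!: rho_pos)
    have rx: "rho x = rho y * q y" using rhoE[of y] Ex by simp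
    have "F x = T0 x" using F(3)[of x] r0(2)[of y] y(1) r(3) x Ex by (auto simp: with_boundary_def)
    then have N: "rho y ^ k *\<^sub>R N y = (rho x)\<^sup>2 *\<^sub>R g x - mat 1"
      using T0(2)[OF x(1)] pos by (simp add: N_def Ex rx power_mult_distrib qpos[OF y(1), THEN less_imp_neq, symmetric])
    have rx': "rho y * (1 - rho y ^ k * \<sigma> y) = rho x" using rx by (simp add: q_def)
    have gx: "g x = (1 / (rho y * (1 - rho y ^ k * \<sigma> y))\<^sup>2) *\<^sub>R (mat 1 + rho y ^ k *\<^sub>R N y)"
      unfolding N rx' using pos(1) by simp
    obtain D where D: "(E has_derivative D) (at y)" "matrix D = J y"
      unfolding E_def J_def K_def
      by (rule matrix_derivative_radial_shift[OF Cinf_on_has_derivative[OF s(2) ys]])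
    \<comment> \<open>\<open>\<Psi>\<close> and \<open>E\<close> are known to agree only on the
      image and the sphere; around an interior point this covers an open set, so the derivative can
      be taken from \<open>E\<close>.\<close>
    have "open (ball p s \<inter> \<Theta> ` V)" "y \<in> ball p s \<inter> \<Theta> ` V" using \<Theta>B(2) ys x by auto
    then have "(\<Psi> has_derivative D) (at y)"
      by (rule has_derivative_transform_within_open[OF D(1)])
        (use s(4) in \<open>auto simp: E_def with_boundary_def\<close>)
    then have "matrix (frechet_derivative \<Psi> (at y)) = J y"
      using frechet_derivative_at D(2) by metis
    then have push: "snd (pushforward (V, \<Theta>) (U, g)) y = transpose (J y) ** g x ** J y"
      using \<Psi>y by (simp add: pushforward_def \<Psi>_def[symmetric] Let_def)
    show ?thesis
      unfolding push T_def J_def q_def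
      by (rule rescaled_pullback_expansion[symmetric, OF _ _ _ gx])
        (use pos qpos[OF y(1)] in \<open>auto simp: q_def\<close>)
  qed
  moreover have "T y = (2 * (y \<bullet> \<phi> y)) *\<^sub>R mat 1 - real (Suc k) *\<^sub>R (outer_prod (\<phi> y) y + outer_prod y (\<phi> y)) + m y"
    if y: "y \<in> ball p r" "y \<in> sphere 0 1" for y
  proof -
    \<comment> \<open>On the sphere every term with a power of \<open>rho\<close> drops out; with
      \<open>q y = 1\<close> the scalar factor reduces to
      \<open>2 * (y \<bullet> \<phi> y)\<close>.\<close>
    have Ey: "E y = y" by (rule E_sphere[OF y(2)])
    have r0k: "rho y = 0" "rho y ^ k = 0" using rho_sphere[OF y(2)] k by (auto simp: zero_power)
    have Fy: "F y = m y"
      using F(3)[of y] T0(3)[OF y(2)] r0(2)[of y] y r(3) Ey by (auto simp: with_boundary_def)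
    have "K y = - (real (Suc k) *\<^sub>R outer_prod (\<phi> y) y)"
      by (simp only: K_def r0k scaleR_zero_left diff_0)
    moreover from this have "transpose (K y) = - (real (Suc k) *\<^sub>R outer_prod y (\<phi> y))"
      by (simp add: vec_eq_iff transpose_def mult.commute)
    moreover have "J y = mat 1" "q y = 1" by (simp_all add: J_def q_def r0k k)
    moreover have "\<sigma> y = y \<bullet> \<phi> y" by (simp add: \<sigma>_def r0k)
    moreover from \<open>q y = 1\<close> have "N y = m y" by (simp add: N_def Ey Fy)
    ultimately show ?thesis
      unfolding T_def by (simp add: r0k transpose_mat scaleR_add_right mult.commute zero_power[OF k] del: of_nat_Suc)
  qed
  ultimately show ?thesis using r(1) by blast
qed

section \<open>The boundary coefficient under transversality\<close>

theorem proposition2p17: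
  fixes k :: nat
    and g :: "'n::finite tensor_germ"
    and m :: "'n tensor"
    and \<Theta> :: "'n map_germ"
  assumes "k > 0"
    and "g \<in> G k"
    and "Sym2_section m"
    and "has_expansion k g m"
    and "adjustment_diffeo k g \<Theta>"
  shows "\<exists>mt :: 'n tensor.
           Sym2_sphere_section mt \<and>
           has_expansion k (pushforward \<Theta> g) mt \<and>
           (\<forall>x\<in>sphere 0 1. \<forall>i j.
              mt x $ i $ j =
                m x $ i $ j
                - (\<Sum>a\<in>UNIV. m x $ a $ j * x $ a) * x $ i
                - (\<Sum>a\<in>UNIV. m x $ i $ a * x $ a) * x $ j
                + (\<Sum>a\<in>UNIV. \<Sum>b\<in>UNIV. m x $ a $ b * (x $ a * x $ b / real k))
                  * ((real k - 1) * x $ i * x $ j + (if i = j then 1 else 0)))"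
proof -
  obtain U g0 where g: "g = (U, g0)" by (cases g)
  obtain V \<Theta>0 where \<Theta>: "\<Theta> = (V, \<Theta>0)" by (cases \<Theta>)
  define U' where "U' = \<Theta>0 ` (U \<inter> V)"
  define g' where "g' = snd (pushforward \<Theta> g)"
  have push: "pushforward \<Theta> g = (U', g')"
    by (simp add: pushforward_def g \<Theta> U'_def g'_def)
  have I0: "(V, \<Theta>0) \<in> I0 (Suc k)" and tr: "transverse (U', g')"
    using assms(5) push by (auto simp: adjustment_diffeo_def \<Theta>)
  have U': "nbhd_infinity U'" using tr by (simp add: transverse_def)
  obtain b where b: "b < 1" "\<And>x w. b < norm x \<Longrightarrow> norm x < 1 \<Longrightarrow> x \<bullet> (g' x *v w) = x \<bullet> (hyp_metric x *v w)"
    using tr by (auto simp: transverse_def eventually_near_infinity)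
  obtain b' where b': "b' < 1" "\<And>x. b' < norm x \<Longrightarrow> norm x < 1 \<Longrightarrow> x \<in> U'"
    using nbhd_infinityD[OF U'] by blast
  interpret mv: bounded_bilinear "(*v) :: real^'n^'n \<Rightarrow> real^'n \<Rightarrow> real^'n"
    by (rule bounded_bilinear_matrix_vector_mult)
  define mt :: "'n tensor" where "mt = (\<lambda>x. \<chi> i j.
                m x $ i $ j
                - (\<Sum>a\<in>UNIV. m x $ a $ j * x $ a) * x $ i
                - (\<Sum>a\<in>UNIV. m x $ i $ a * x $ a) * x $ j
                + (\<Sum>a\<in>UNIV. \<Sum>b\<in>UNIV. m x $ a $ b * (x $ a * x $ b / real k))
                  * ((real k - 1) * x $ i * x $ j + (if i = j then 1 else 0)))"
  \<comment> \<open>The values on the sphere are prescribed by the formula; that they continue the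
    interior values smoothly is the content of the local claim.\<close>
  define Tt where "Tt = (\<lambda>y. if y \<in> sphere 0 1 then mt y
    else (1 / rho y ^ k) *\<^sub>R ((rho y)\<^sup>2 *\<^sub>R g' y - mat 1))"
  \<comment> \<open>The last clause keeps transversality on the sphere at hand, for showing that
    \<open>mt\<close> annihilates the position vector.\<close>
  have loc: "\<exists>r>0. \<exists>T. Cinf_on (ball p r) T \<and>
      (\<forall>y\<in>ball p r. y \<in> with_boundary U' \<longrightarrow> T y = Tt y) \<and>
      (\<forall>y\<in>ball p r. y \<in> sphere 0 1 \<longrightarrow> (\<forall>w. y \<bullet> (mt y *v w) = 0))"
    if p: "p \<in> with_boundary U'" for p
  proof -
    obtain r T where r: "r > 0" "Cinf_on (ball p r) T"
      "\<And>y. y \<in> ball p r \<Longrightarrow> y \<in> U' \<Longrightarrow> T y = (1 / rho y ^ k) *\<^sub>R ((rho y)\<^sup>2 *\<^sub>R g' y - mat 1)"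
      "\<And>y. y \<in> ball p r \<Longrightarrow> y \<in> sphere 0 1 \<Longrightarrow>
        \<exists>f. T y = (2 * (y \<bullet> f)) *\<^sub>R mat 1 - real (Suc k) *\<^sub>R (outer_prod f y + outer_prod y f) + m y"
      using pushforward_expansion_local[OF assms(1) I0 assms(4)[unfolded g], of p] p
      unfolding U'_def g'_def \<Theta> g by blast
    \<comment> \<open>\<open>rho^2\<close> times the hyperbolic metric is the identity, so in the
      collar transversality makes \<open>z \<bullet> (T z *v w)\<close> vanish exactly; a bound with
      constant 0 carries this to the sphere.\<close>
    have T_tr: "y \<bullet> (T y *v w) = 0" if y: "y \<in> ball p r" "y \<in> sphere 0 1" for y w
    proof -
      obtain s where s: "s > 0" "\<And>z. z \<in> ball y s \<Longrightarrow> z \<in> ball 0 1 \<Longrightarrow> max b b' < norm z \<and> norm z < 1"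
        using collar_contains_half_ball[OF y(2), of "max b b'"] b(1) b'(1) by auto
      define S where "S = ball p r \<inter> ball y s"
      have S: "open S" "y \<in> S" using y(1) s(1) by (auto simp: S_def)
      have "Cinf_on S (\<lambda>z. z \<bullet> (T z *v w))"
        by (intro Cinf_on_inner Cinf_on_id Cinf_on_bilinear[OF bounded_bilinear_matrix_vector_mult]
            Cinf_on_const Cinf_on_subset[OF r(2)] S) (simp add: S_def)
      moreover have "norm (z \<bullet> (T z *v w)) \<le> 0 * rho z ^ 1" if z: "z \<in> S" "z \<in> ball 0 1" for z
      proof -
        have zb: "b < norm z" "b' < norm z" "norm z < 1" using s(2)[of z] z by (auto simp: S_def)
        have "z \<in> U'" by (rule b'(2)[OF zb(2,3)])
        then have "T z = (1 / rho z ^ k) *\<^sub>R ((rho z)\<^sup>2 *\<^sub>R g' z - mat 1)"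
          using r(3) z by (simp add: S_def)
        moreover have "rho z > 0" using z(2) by (rule rho_pos)
        ultimately show ?thesis
          using b(2)[OF zb(1,3), of w]
          by (simp add: mv.scaleR_left mv.diff_left hyp_metric_def inner_diff_right)
      qed
      ultimately show ?thesis
        by (rule Cinf_on_eq_zero_on_sphere[OF _ S(2) y(2) zero_less_one])
    qed
    have T_mt: "T y = mt y" if y: "y \<in> ball p r" "y \<in> sphere 0 1" for y
    proof -
      obtain f where f: "T y = (2 * (y \<bullet> f)) *\<^sub>R mat 1 - real (Suc k) *\<^sub>R (outer_prod f y + outer_prod y f) + m y"
        using r(4)[OF y] by blast
      have "transpose (m y) = m y" using assms(3) y(2) by (simp add: Sym2_section_def)
      from transverse_leading_term[OF assms(1) y(2) this f T_tr[OF y]]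
      show ?thesis by (simp add: vec_eq_iff mt_def)
    qed
    have "T y = Tt y" if "y \<in> ball p r" "y \<in> with_boundary U'" for y
      using that T_mt[OF that(1)] r(3)[OF that(1)] by (auto simp: Tt_def with_boundary_def)
    then show ?thesis using r(1,2) T_tr T_mt by (metis (no_types, lifting))
  qed
  have smooth: "smooth_on (with_boundary U') Tt"
    unfolding smooth_on_def
  proof
    fix p assume "p \<in> with_boundary U'"
    from loc[OF this] obtain r T where "r > 0" "Cinf_on (ball p r) T"
      "\<forall>y\<in>ball p r. y \<in> with_boundary U' \<longrightarrow> T y = Tt y" by blast
    then show "\<exists>W F. open W \<and> p \<in> W \<and> (\<forall>k. Ck_on k W F) \<and> (\<forall>x\<in>with_boundary U' \<inter> W. F x = Tt x)"
      by (intro exI[of _ "ball p r"] exI[of _ T]) (auto simp: Cinf_on_def)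
  qed
  \<comment> \<open>Smoothness is read off from \<open>Tt\<close>, whose restriction to the sphere
    is \<open>mt\<close>, instead of from the formula in \<open>m\<close>.\<close>
  have "smooth_on (sphere 0 1) mt"
    unfolding smooth_on_def
  proof
    fix p :: "real^'n" assume "p \<in> sphere 0 1"
    then obtain W F where "open W" "p \<in> W" "\<forall>k. Ck_on k W F" "\<forall>x\<in>with_boundary U' \<inter> W. F x = Tt x"
      using smooth unfolding smooth_on_def with_boundary_def by blast
    then show "\<exists>W F. open W \<and> p \<in> W \<and> (\<forall>k. Ck_on k W F) \<and> (\<forall>x\<in>sphere 0 1 \<inter> W. F x = mt x)"
      by (intro exI[of _ W] exI[of _ F]) (auto simp: with_boundary_def Tt_def)
  qed
  moreover have mt_sym: "transpose (mt x) = mt x" if "x \<in> sphere 0 1" for x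
  proof -
    have "transpose (m x) = m x" using assms(3) that by (simp add: Sym2_section_def)
    then have sym: "m x $ a $ b = m x $ b $ a" for a b
      by (rule transpose_eq_self_nth)
    have "(\<Sum>a\<in>UNIV. m x $ a $ j * x $ a) = (\<Sum>a\<in>UNIV. m x $ j $ a * x $ a)" for j
      by (simp only: sym[of _ j])
    then have "mt x $ j $ i = mt x $ i $ j" for i j
      unfolding mt_def using sym[of i j] by (simp add: mult.assoc mult.commute[of "x $ i"])
    then show ?thesis
      by (simp add: vec_eq_iff transpose_def)
  qed
  moreover have "mt x *v x = 0" if x: "x \<in> sphere 0 1" for x
  proof -
    have "x \<in> with_boundary U'" using x by (simp add: with_boundary_def)
    from loc[OF this] obtain r where "r > 0"
      "\<forall>y\<in>ball x r. y \<in> sphere 0 1 \<longrightarrow> (\<forall>w. y \<bullet> (mt y *v w) = 0)" by blast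
    \<comment> \<open>Taking \<open>w = mt x *v x\<close> makes this a squared norm, by symmetry of
      \<open>mt x\<close>.\<close>
    then have "x \<bullet> (mt x *v (mt x *v x)) = 0" using x centre_in_ball by blast
    then show ?thesis
      using mt_sym[OF x] by (metis dot_lmul_matrix inner_eq_zero_iff transpose_matrix_vector)
  qed
  ultimately have "Sym2_sphere_section mt"
    by (simp add: Sym2_sphere_section_def Sym2_section_def)
  moreover have "has_expansion k (pushforward \<Theta> g) mt"
  proof -
    have "y \<notin> sphere 0 1" if "y \<in> U'" for y
      using that U' by (auto simp: nbhd_infinity_def)
    then have "\<forall>x\<in>U'. Tt x = (1 / rho x ^ k) *\<^sub>R ((rho x)\<^sup>2 *\<^sub>R g' x - mat 1)"
      "\<forall>x\<in>sphere 0 1. Tt x = mt x"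
      by (auto simp: Tt_def)
    then show ?thesis unfolding push has_expansion_def using U' smooth by blast
  qed
  moreover have "mt x $ i $ j =
                m x $ i $ j
                - (\<Sum>a\<in>UNIV. m x $ a $ j * x $ a) * x $ i
                - (\<Sum>a\<in>UNIV. m x $ i $ a * x $ a) * x $ j
                + (\<Sum>a\<in>UNIV. \<Sum>b\<in>UNIV. m x $ a $ b * (x $ a * x $ b / real k))
                  * ((real k - 1) * x $ i * x $ j + (if i = j then 1 else 0))" for x i j
    by (simp add: mt_def)
  ultimately show ?thesis by blast
qed

end
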